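(* Let $\rho:\widehat G\to G$ be a central extension of a Lie group $G$ by $U(1)$, and let $Y\to M$ be a principal $G$-bundle over a smooth manifold $M$. If $Y$ is flat, then its Dixmier–Douady class (associated to $\rho$) is $0$ in $H^3(M,\mathbb R)$.
   Context: $G$ is a Lie group; it may be infinite dimensional provided it admits smooth partitions of unity. The central extension $1\to U(1)\to\widehat G\xrightarrow{\rho}G\to1$ of Lie groups is regarded as a principal $U(1)$-bundle over $G$. A principal $G$-bundle is flat if it admits local trivializations with locally constant transition functions, i.e. its structure group reduces to $G$ with the discrete topology. Dixmier–Douady class: let $\{U_\alpha\}$ be a Leray covering of $M$ (all nonempty finite intersections contractible) with transition functions $g_{\alpha\beta}:U_{\alpha\beta}\to G$ of $Y$, $g_{\alpha\beta}g_{\beta\gamma}=g_{\alpha\gamma}$. Choose lifts $\hat g_{\alpha\beta}:U_{\alpha\beta}\to\widehat G$ with $\rho\circ\hat g_{\alpha\beta}=g_{\alpha\beta}$ and set $c_{\alpha\beta\gamma}=\hat g_{\beta\gamma}\hat g_{\alpha\gamma}^{-1}\hat g_{\alpha\beta}:U_{\alpha\beta\gamma}\to U(1)$. This is a $U(1)$-valued Čech cocycle, and its class in $H^2(M,\underline{U(1)})\cong H^3(M,\mathbb Z)$, where $\underline{U(1)}$ is the sheaf of continuous $U(1)$-valued functions, is the Dixmier–Douady class of $Y$ associated to $\rho$. Its class in $H^3(M,\mathbb R)$ is the image under $H^3(M,\mathbb Z)\to H^3(M,\mathbb R)$. *)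

theory Defs
  imports "HOL-Analysis.Analysis" "HOL-Algebra.Coset" "HOL-Algebra.FiniteProduct"
    "HOL-Algebra.Elementary_Groups"
begin

section \<open>Smooth maps between locally convex spaces\<close>

class locally_convex_space = real_vector + topological_ab_group_add + t2_space +
  assumes tendsto_scaleR_nhds:
    "filterlim (\<lambda>p. fst p *\<^sub>R snd p) (nhds (r *\<^sub>R x)) (nhds (r::real) \<times>\<^sub>F nhds x)"
  and locally_convex:
    "open U \<Longrightarrow> 0 \<in> U \<Longrightarrow> \<exists>V. open V \<and> 0 \<in> V \<and> V \<subseteq> U \<and>
       (\<forall>x\<in>V. \<forall>y\<in>V. \<forall>u\<ge>0::real. \<forall>v\<ge>0. u + v = 1 \<longrightarrow> u *\<^sub>R x + v *\<^sub>R y \<in> V)"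

instance real_normed_vector \<subseteq> locally_convex_space
proof
  fix r :: real and x :: 'a
  have "((\<lambda>p. fst p *\<^sub>R snd p) \<longlongrightarrow> r *\<^sub>R x) (nhds r \<times>\<^sub>F nhds x)"
    by (intro tendsto_scaleR filterlim_fst filterlim_snd)
  then show "filterlim (\<lambda>p. fst p *\<^sub>R snd p) (nhds (r *\<^sub>R x)) (nhds r \<times>\<^sub>F nhds x)" .
next
  fix U :: "'a set"
  assume "open U" "0 \<in> U"
  then obtain e where "e > 0" "ball 0 e \<subseteq> U"
    using open_contains_ball by blast
  then show "\<exists>V. open V \<and> 0 \<in> V \<and> V \<subseteq> U \<and>
       (\<forall>x\<in>V. \<forall>y\<in>V. \<forall>u\<ge>0::real. \<forall>v\<ge>0. u + v = 1 \<longrightarrow> u *\<^sub>R x + v *\<^sub>R y \<in> V)"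
    using convex_ball[of "0::'a" e] unfolding convex_def
    by (intro exI[of _ "ball 0 e"]) auto
qed

definition finite_dimensional :: "'e::real_vector itself \<Rightarrow> bool" where
  "finite_dimensional _ \<longleftrightarrow> (\<exists>B::'e set. finite B \<and> span B = UNIV)"

text \<open>Smoothness in the sense of Michal and Bastiani, for a map on an open set: \<open>D k v x\<close> is the
  iterated directional derivative of \<open>f\<close> at \<open>x\<close> in the directions \<open>v 0, \<dots>, v (k - 1)\<close>, and every
  \<open>D k\<close> has to be jointly continuous. Since \<open>D k v x\<close> depends only on the first \<open>k\<close> entries of \<open>v\<close>,
  the product topology on sequences of directions gives the same notion as the product topology on
  \<open>k\<close>-tuples. On finite-dimensional spaces this is the usual infinite differentiability.\<close>
definition smooth_on_open ::
  "'e::{real_vector,topological_space} set \<Rightarrow> ('e \<Rightarrow> 'f::{real_vector,topological_space}) \<Rightarrow> bool"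
  where
  "smooth_on_open S f \<longleftrightarrow> open S \<and>
     (\<exists>D :: nat \<Rightarrow> (nat \<Rightarrow> 'e) \<Rightarrow> 'e \<Rightarrow> 'f.
        (\<forall>x\<in>S. \<forall>v. D 0 v x = f x) \<and>
        (\<forall>k. \<forall>x\<in>S. \<forall>v. ((\<lambda>t::real. (1 / t) *\<^sub>R (D k v (x + t *\<^sub>R v k) - D k v x))
                              \<longlongrightarrow> D (Suc k) v x) (at 0)) \<and>
        (\<forall>k. continuous_on (S \<times> UNIV) (\<lambda>(x, v). D k v x)))"


section \<open>Manifolds and Lie groups\<close>

text \<open>An atlas is a set of pairs \<open>(U, \<phi>)\<close> of a chart domain and a coordinate map, the values of
  \<open>\<phi>\<close> outside \<open>U\<close> being irrelevant. Atlases need not be maximal.\<close>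
record ('m, 'e) manifold =
  mtop :: "'m topology"
  atlas :: "('m set \<times> ('m \<Rightarrow> 'e)) set"

definition is_smooth_manifold :: "('m, 'e::locally_convex_space) manifold \<Rightarrow> bool" where
  "is_smooth_manifold X \<longleftrightarrow>
     Hausdorff_space (mtop X) \<and>
     \<Union> (fst ` atlas X) = topspace (mtop X) \<and>
     (\<forall>(U, \<phi>) \<in> atlas X. openin (mtop X) U \<and> open (\<phi> ` U) \<and>
        homeomorphic_map (subtopology (mtop X) U) (top_of_set (\<phi> ` U)) \<phi>) \<and>
     (\<forall>(U, \<phi>) \<in> atlas X. \<forall>(V, \<psi>) \<in> atlas X.
        smooth_on_open (\<phi> ` (U \<inter> V)) (\<psi> \<circ> inv_into U \<phi>))"

definition is_finite_dim_manifold :: "('m, 'e::real_normed_vector) manifold \<Rightarrow> bool" where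
  "is_finite_dim_manifold X \<longleftrightarrow>
     is_smooth_manifold X \<and> second_countable (mtop X) \<and> finite_dimensional TYPE('e)"

definition smooth_map ::
  "('m, 'e::{real_vector,topological_space}) manifold \<Rightarrow>
   ('n, 'f::{real_vector,topological_space}) manifold \<Rightarrow> ('m \<Rightarrow> 'n) \<Rightarrow> bool" where
  "smooth_map X Y f \<longleftrightarrow>
     continuous_map (mtop X) (mtop Y) f \<and>
     (\<forall>(U, \<phi>) \<in> atlas X. \<forall>(V, \<psi>) \<in> atlas Y.
        smooth_on_open (\<phi> ` {x \<in> U. f x \<in> V}) (\<psi> \<circ> f \<circ> inv_into U \<phi>))"

definition diffeomorphism ::
  "('m, 'e::{real_vector,topological_space}) manifold \<Rightarrow>
   ('n, 'f::{real_vector,topological_space}) manifold \<Rightarrow> ('m \<Rightarrow> 'n) \<Rightarrow> bool" where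
  "diffeomorphism X Y f \<longleftrightarrow>
     bij_betw f (topspace (mtop X)) (topspace (mtop Y)) \<and>
     smooth_map X Y f \<and> smooth_map Y X (inv_into (topspace (mtop X)) f)"

definition prod_manifold ::
  "('m, 'e) manifold \<Rightarrow> ('n, 'f) manifold \<Rightarrow> ('m \<times> 'n, 'e \<times> 'f) manifold" where
  "prod_manifold X Y =
     \<lparr>mtop = prod_topology (mtop X) (mtop Y),
      atlas = {(U \<times> V, map_prod \<phi> \<psi>) | U \<phi> V \<psi>. (U, \<phi>) \<in> atlas X \<and> (V, \<psi>) \<in> atlas Y}\<rparr>"

definition open_submanifold :: "('m, 'e) manifold \<Rightarrow> 'm set \<Rightarrow> ('m, 'e) manifold" where
  "open_submanifold X W =
     \<lparr>mtop = subtopology (mtop X) W, atlas = {(U \<inter> W, \<phi>) | U \<phi>. (U, \<phi>) \<in> atlas X}\<rparr>"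

definition real_manifold :: "(real, real) manifold" where
  "real_manifold = \<lparr>mtop = euclideanreal, atlas = {(UNIV, id)}\<rparr>"

definition admits_smooth_partitions_of_unity ::
  "('m, 'e::{real_vector,topological_space}) manifold \<Rightarrow> bool" where
  "admits_smooth_partitions_of_unity X \<longleftrightarrow>
     (\<forall>\<U>. (\<forall>U\<in>\<U>. openin (mtop X) U) \<and> \<Union>\<U> = topspace (mtop X) \<longrightarrow>
        (\<exists>f :: 'm set \<Rightarrow> 'm \<Rightarrow> real.
           (\<forall>U\<in>\<U>. smooth_map X real_manifold (f U) \<and>
              (\<forall>x\<in>topspace (mtop X). 0 \<le> f U x) \<and>
              (mtop X) closure_of {x \<in> topspace (mtop X). f U x \<noteq> 0} \<subseteq> U) \<and>
           (\<forall>x\<in>topspace (mtop X). \<exists>N. openin (mtop X) N \<and> x \<in> N \<and>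
              finite {U \<in> \<U>. \<exists>y\<in>N. f U y \<noteq> 0}) \<and>
           (\<forall>x\<in>topspace (mtop X). (\<Sum>U | U \<in> \<U> \<and> f U x \<noteq> 0. f U x) = 1)))"

record ('g, 'e) lie_group = "'g monoid" +
  mfd :: "('g, 'e) manifold"

definition is_lie_group :: "('g, 'e::locally_convex_space) lie_group \<Rightarrow> bool" where
  "is_lie_group G \<longleftrightarrow>
     group G \<and> is_smooth_manifold (mfd G) \<and> topspace (mtop (mfd G)) = carrier G \<and>
     smooth_map (prod_manifold (mfd G) (mfd G)) (mfd G) (\<lambda>(x, y). x \<otimes>\<^bsub>G\<^esub> y) \<and>
     smooth_map (mfd G) (mfd G) (\<lambda>x. inv\<^bsub>G\<^esub> x)"

text \<open>The charts of \<open>U(1)\<close> are the angle functions on the circle minus the point \<open>- cis t\<close>.\<close>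
definition U1 :: "(complex, real) lie_group" where
  "U1 = \<lparr>carrier = sphere 0 1, monoid.mult = (*), one = 1,
         mfd = \<lparr>mtop = top_of_set (sphere 0 1),
                atlas = {(sphere 0 1 - {- cis t}, \<lambda>z. Arg (z / cis t)) | t. True}\<rparr>\<rparr>"


section \<open>Principal bundles and central extensions\<close>

text \<open>A local trivialization over \<open>U\<close> is an equivariant diffeomorphism
  \<open>\<Phi> : U \<times> G \<rightarrow> pr\<^sup>-\<^sup>1(U)\<close> over \<open>U\<close>. Structure groups act from the right.\<close>
definition local_trivialization ::
  "('p, 'q::{real_vector,topological_space}) manifold \<Rightarrow>
   ('m, 'e::{real_vector,topological_space}) manifold \<Rightarrow>
   ('g, 'f::{real_vector,topological_space}) lie_group \<Rightarrow>
   ('p \<Rightarrow> 'm) \<Rightarrow> ('p \<Rightarrow> 'g \<Rightarrow> 'p) \<Rightarrow> 'm set \<Rightarrow> ('m \<times> 'g \<Rightarrow> 'p) \<Rightarrow> bool" where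
  "local_trivialization Y M G pr act U \<Phi> \<longleftrightarrow>
     openin (mtop M) U \<and>
     diffeomorphism (prod_manifold (open_submanifold M U) (mfd G))
       (open_submanifold Y {p \<in> topspace (mtop Y). pr p \<in> U}) \<Phi> \<and>
     (\<forall>x\<in>U. \<forall>g\<in>carrier G. pr (\<Phi> (x, g)) = x \<and>
        (\<forall>h\<in>carrier G. \<Phi> (x, g \<otimes>\<^bsub>G\<^esub> h) = act (\<Phi> (x, g)) h))"

definition principal_bundle ::
  "('p, 'q::locally_convex_space) manifold \<Rightarrow> ('m, 'e::locally_convex_space) manifold \<Rightarrow>
   ('g, 'f::locally_convex_space) lie_group \<Rightarrow>
   ('p \<Rightarrow> 'm) \<Rightarrow> ('p \<Rightarrow> 'g \<Rightarrow> 'p) \<Rightarrow> bool" where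
  "principal_bundle Y M G pr act \<longleftrightarrow>
     is_smooth_manifold Y \<and> is_smooth_manifold M \<and> is_lie_group G \<and>
     smooth_map Y M pr \<and>
     smooth_map (prod_manifold Y (mfd G)) Y (\<lambda>(p, g). act p g) \<and>
     (\<forall>p\<in>topspace (mtop Y). act p \<one>\<^bsub>G\<^esub> = p \<and>
        (\<forall>g\<in>carrier G. \<forall>h\<in>carrier G. act (act p g) h = act p (g \<otimes>\<^bsub>G\<^esub> h))) \<and>
     (\<forall>x\<in>topspace (mtop M). \<exists>U \<Phi>. x \<in> U \<and> local_trivialization Y M G pr act U \<Phi>)"

definition transition_function ::
  "('g, 'f) lie_group \<Rightarrow> 'm set \<Rightarrow> ('m \<times> 'g \<Rightarrow> 'p) \<Rightarrow> 'm set \<Rightarrow> ('m \<times> 'g \<Rightarrow> 'p) \<Rightarrow>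
   ('m \<Rightarrow> 'g) \<Rightarrow> bool" where
  "transition_function G U \<Phi> V \<Psi> g \<longleftrightarrow>
     (\<forall>x\<in>U \<inter> V. g x \<in> carrier G \<and>
        (\<forall>h\<in>carrier G. \<Psi> (x, h) = \<Phi> (x, g x \<otimes>\<^bsub>G\<^esub> h)))"

text \<open>Locally constant maps are expressed as continuous maps to the discrete group.\<close>
definition flat_bundle ::
  "('p, 'q::{real_vector,topological_space}) manifold \<Rightarrow>
   ('m, 'e::{real_vector,topological_space}) manifold \<Rightarrow>
   ('g, 'f::{real_vector,topological_space}) lie_group \<Rightarrow>
   ('p \<Rightarrow> 'm) \<Rightarrow> ('p \<Rightarrow> 'g \<Rightarrow> 'p) \<Rightarrow> bool" where
  "flat_bundle Y M G pr act \<longleftrightarrow>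
     (\<exists>\<T> :: ('m set \<times> ('m \<times> 'g \<Rightarrow> 'p)) set.
        \<Union> (fst ` \<T>) = topspace (mtop M) \<and>
        (\<forall>(U, \<Phi>) \<in> \<T>. local_trivialization Y M G pr act U \<Phi>) \<and>
        (\<forall>(U, \<Phi>) \<in> \<T>. \<forall>(V, \<Psi>) \<in> \<T>. \<exists>g.
           transition_function G U \<Phi> V \<Psi> g \<and>
           continuous_map (subtopology (mtop M) (U \<inter> V)) (discrete_topology (carrier G)) g))"

definition central_extension ::
  "('h, 'a::locally_convex_space) lie_group \<Rightarrow> ('g, 'f::locally_convex_space) lie_group \<Rightarrow>
   (complex \<Rightarrow> 'h) \<Rightarrow> ('h \<Rightarrow> 'g) \<Rightarrow> bool" where
  "central_extension Gh G \<iota> \<rho> \<longleftrightarrow>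
     is_lie_group Gh \<and> is_lie_group G \<and>
     \<iota> \<in> hom U1 Gh \<and> smooth_map (mfd U1) (mfd Gh) \<iota> \<and> inj_on \<iota> (carrier U1) \<and>
     \<rho> \<in> hom Gh G \<and> smooth_map (mfd Gh) (mfd G) \<rho> \<and> \<rho> ` carrier Gh = carrier G \<and>
     \<iota> ` carrier U1 = kernel Gh G \<rho> \<and>
     (\<forall>z\<in>carrier U1. \<forall>p\<in>carrier Gh. \<iota> z \<otimes>\<^bsub>Gh\<^esub> p = p \<otimes>\<^bsub>Gh\<^esub> \<iota> z) \<and>
     principal_bundle (mfd Gh) (mfd G) U1 \<rho> (\<lambda>p z. p \<otimes>\<^bsub>Gh\<^esub> \<iota> z)"


section \<open>Cech cohomology\<close>

text \<open>Coefficients are the sheaf of continuous functions with values in an abelian topological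
  group, given by a group \<open>A\<close> and a topology \<open>T\<close> on its carrier; a discrete topology yields a
  constant sheaf. A \<open>p\<close>-simplex of a family \<open>(U i)\<close> of open sets, \<open>i \<in> I\<close>, is a list of \<open>p + 1\<close>
  indices. Only the values of a cochain at \<open>p\<close>-simplices and at points of the corresponding
  intersections matter.\<close>

definition simplices :: "'i set \<Rightarrow> nat \<Rightarrow> 'i list set" where
  "simplices I p = {\<sigma>. set \<sigma> \<subseteq> I \<and> length \<sigma> = Suc p}"

definition supp :: "('i \<Rightarrow> 'm set) \<Rightarrow> 'i list \<Rightarrow> 'm set" where
  "supp U \<sigma> = (\<Inter>i\<in>set \<sigma>. U i)"

definition cech_cochain ::
  "'m topology \<Rightarrow> 'a topology \<Rightarrow> nat \<Rightarrow> 'i set \<Rightarrow> ('i \<Rightarrow> 'm set) \<Rightarrow> ('i list \<Rightarrow> 'm \<Rightarrow> 'a) \<Rightarrow> bool"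
  where
  "cech_cochain X T p I U c \<longleftrightarrow>
     (\<forall>\<sigma>\<in>simplices I p. continuous_map (subtopology X (supp U \<sigma>)) T (c \<sigma>))"

definition cech_diff ::
  "('a, 'b) monoid_scheme \<Rightarrow> ('i list \<Rightarrow> 'm \<Rightarrow> 'a) \<Rightarrow> 'i list \<Rightarrow> 'm \<Rightarrow> 'a" where
  "cech_diff A c \<sigma> x =
     finprod A (\<lambda>j. let y = c (take j \<sigma> @ drop (Suc j) \<sigma>) x in if even j then y else inv\<^bsub>A\<^esub> y)
       {..<length \<sigma>}"

definition cech_cocycle ::
  "'m topology \<Rightarrow> ('a, 'b) monoid_scheme \<Rightarrow> 'a topology \<Rightarrow> nat \<Rightarrow>
   'i set \<Rightarrow> ('i \<Rightarrow> 'm set) \<Rightarrow> ('i list \<Rightarrow> 'm \<Rightarrow> 'a) \<Rightarrow> bool" where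
  "cech_cocycle X A T p I U c \<longleftrightarrow>
     cech_cochain X T p I U c \<and>
     (\<forall>\<sigma>\<in>simplices I (Suc p). \<forall>x\<in>supp U \<sigma>. cech_diff A c \<sigma> x = \<one>\<^bsub>A\<^esub>)"

text \<open>Cech cohomology of \<open>X\<close> is the colimit over all open covers. As usual it is computed on the
  cofinal system of covers \<open>(V x)\<close> indexed by the points of \<open>X\<close> with \<open>x \<in> V x\<close>, ordered by
  \<open>W x \<subseteq> V x\<close> for all \<open>x\<close>; the refinement maps are then identities on indices. A cohomology class
  is the set of all pairs \<open>(V, c)\<close> that represent it.\<close>

type_synonym ('m, 'a) cech_rep = "('m \<Rightarrow> 'm set) \<times> ('m list \<Rightarrow> 'm \<Rightarrow> 'a)"

definition pointed_cover :: "'m topology \<Rightarrow> ('m \<Rightarrow> 'm set) \<Rightarrow> bool" where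
  "pointed_cover X V \<longleftrightarrow> (\<forall>x\<in>topspace X. openin X (V x) \<and> x \<in> V x)"

definition cech_reps ::
  "'m topology \<Rightarrow> ('a, 'b) monoid_scheme \<Rightarrow> 'a topology \<Rightarrow> nat \<Rightarrow> ('m, 'a) cech_rep set" where
  "cech_reps X A T p = {(V, c). pointed_cover X V \<and> cech_cocycle X A T p (topspace X) V c}"

definition cech_rel ::
  "'m topology \<Rightarrow> ('a, 'b) monoid_scheme \<Rightarrow> 'a topology \<Rightarrow> nat \<Rightarrow> ('m, 'a) cech_rep rel" where
  "cech_rel X A T p =
     {((V, c), (V', c')). (V, c) \<in> cech_reps X A T p \<and> (V', c') \<in> cech_reps X A T p \<and>
        (\<exists>W. pointed_cover X W \<and> (\<forall>x\<in>topspace X. W x \<subseteq> V x \<inter> V' x) \<and>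
           (case p of
              0 \<Rightarrow> \<forall>\<sigma>\<in>simplices (topspace X) 0. \<forall>x\<in>supp W \<sigma>. c \<sigma> x = c' \<sigma> x
            | Suc q \<Rightarrow> \<exists>b. cech_cochain X T q (topspace X) W b \<and>
                (\<forall>\<sigma>\<in>simplices (topspace X) p. \<forall>x\<in>supp W \<sigma>.
                   c \<sigma> x = c' \<sigma> x \<otimes>\<^bsub>A\<^esub> cech_diff A b \<sigma> x)))}"

definition cech_cohomology ::
  "'m topology \<Rightarrow> ('a, 'b) monoid_scheme \<Rightarrow> 'a topology \<Rightarrow> nat \<Rightarrow> ('m, 'a) cech_rep set set" where
  "cech_cohomology X A T p = cech_reps X A T p // cech_rel X A T p"

definition cech_zero ::
  "'m topology \<Rightarrow> ('a, 'b) monoid_scheme \<Rightarrow> 'a topology \<Rightarrow> nat \<Rightarrow> ('m, 'a) cech_rep set" where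
  "cech_zero X A T p = cech_rel X A T p `` {(\<lambda>_. topspace X, \<lambda>_ _. \<one>\<^bsub>A\<^esub>)}"

text \<open>The class of a cocycle on an arbitrary open cover \<open>(U i)\<close>: choose \<open>a x\<close> with \<open>x \<in> U (a x)\<close>
  and pull back to the pointed cover \<open>U \<circ> a\<close>. The class does not depend on \<open>a\<close>, so no choice
  is made and the representatives arising from all \<open>a\<close> are collected.\<close>
definition cech_class ::
  "'m topology \<Rightarrow> ('a, 'b) monoid_scheme \<Rightarrow> 'a topology \<Rightarrow> nat \<Rightarrow>
   'i set \<Rightarrow> ('i \<Rightarrow> 'm set) \<Rightarrow> ('i list \<Rightarrow> 'm \<Rightarrow> 'a) \<Rightarrow> ('m, 'a) cech_rep set" where
  "cech_class X A T p I U c =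
     cech_rel X A T p `` {(U \<circ> a, \<lambda>\<sigma>. c (map a \<sigma>)) | a. \<forall>x\<in>topspace X. a x \<in> I \<and> x \<in> U (a x)}"

definition real_group :: "real monoid" where
  "real_group = \<lparr>carrier = UNIV, monoid.mult = (+), one = 0\<rparr>"

abbreviation H2_U1 :: "'m topology \<Rightarrow> ('m, complex) cech_rep set set" where
  "H2_U1 X \<equiv> cech_cohomology X U1 (mtop (mfd U1)) 2"

abbreviation H3_int :: "'m topology \<Rightarrow> ('m, int) cech_rep set set" where
  "H3_int X \<equiv> cech_cohomology X integer_group (discrete_topology UNIV) 3"

abbreviation H3_real :: "'m topology \<Rightarrow> ('m, real) cech_rep set set" where
  "H3_real X \<equiv> cech_cohomology X real_group (discrete_topology UNIV) 3"

abbreviation H3_real_zero :: "'m topology \<Rightarrow> ('m, real) cech_rep set" where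
  "H3_real_zero X \<equiv> cech_zero X real_group (discrete_topology UNIV) 3"

text \<open>The isomorphism from \<open>H2_U1 X\<close> to \<open>H3_int X\<close> is the connecting homomorphism of the exponential
  sequence \<open>0 \<rightarrow> \<int> \<rightarrow> \<real> \<rightarrow> U(1) \<rightarrow> 0\<close> of sheaves of continuous functions: represent a class by
  \<open>exp (2 \<pi> i b)\<close> for a continuous real cochain \<open>b\<close>, and take the class of the integral cocycle \<open>n\<close>
  that is the coboundary of \<open>b\<close>. All such \<open>b\<close> lead to the same class.\<close>
definition exp_connecting ::
  "'m topology \<Rightarrow> ('m, complex) cech_rep set \<Rightarrow> ('m, int) cech_rep set" where
  "exp_connecting X \<kappa> =
     cech_rel X integer_group (discrete_topology UNIV) 3 ``
       {(V, n) | V n. \<exists>b. cech_cochain X euclideanreal 2 (topspace X) V b \<and>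
          (V, \<lambda>\<sigma> x. cis (2 * pi * b \<sigma> x)) \<in> \<kappa> \<and>
          (\<forall>\<sigma>\<in>simplices (topspace X) 3. \<forall>x\<in>supp V \<sigma>.
             real_of_int (n \<sigma> x) = cech_diff real_group b \<sigma> x)}"

definition int_to_real_H3 ::
  "'m topology \<Rightarrow> ('m, int) cech_rep set \<Rightarrow> ('m, real) cech_rep set" where
  "int_to_real_H3 X \<kappa> =
     cech_rel X real_group (discrete_topology UNIV) 3 ``
       {(V, \<lambda>\<sigma> x. real_of_int (n \<sigma> x)) | V n. (V, n) \<in> \<kappa>}"


section \<open>The Dixmier--Douady class\<close>

definition leray_cover :: "'m topology \<Rightarrow> 'i set \<Rightarrow> ('i \<Rightarrow> 'm set) \<Rightarrow> bool" where
  "leray_cover X I U \<longleftrightarrow>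
     (\<forall>i\<in>I. openin X (U i)) \<and> (\<Union>i\<in>I. U i) = topspace X \<and>
     (\<forall>J. J \<subseteq> I \<and> finite J \<and> J \<noteq> {} \<and> (\<Inter>i\<in>J. U i) \<noteq> {} \<longrightarrow>
        contractible_space (subtopology X (\<Inter>i\<in>J. U i)))"

text \<open>The choices entering the construction: a Leray cover, local trivializations over its members,
  their transition functions \<open>g i j\<close>, and lifts \<open>gh i j\<close> of the latter to the extension.\<close>
definition dixmier_douady_data ::
  "('h, 'a) lie_group \<Rightarrow> ('g, 'f::{real_vector,topological_space}) lie_group \<Rightarrow> ('h \<Rightarrow> 'g) \<Rightarrow>
   ('p, 'q::{real_vector,topological_space}) manifold \<Rightarrow>
   ('m, 'e::{real_vector,topological_space}) manifold \<Rightarrow> ('p \<Rightarrow> 'm) \<Rightarrow> ('p \<Rightarrow> 'g \<Rightarrow> 'p) \<Rightarrow>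
   'i set \<Rightarrow> ('i \<Rightarrow> 'm set) \<Rightarrow> ('i \<Rightarrow> 'm \<times> 'g \<Rightarrow> 'p) \<Rightarrow>
   ('i \<Rightarrow> 'i \<Rightarrow> 'm \<Rightarrow> 'g) \<Rightarrow> ('i \<Rightarrow> 'i \<Rightarrow> 'm \<Rightarrow> 'h) \<Rightarrow> bool" where
  "dixmier_douady_data Gh G \<rho> Y M pr act I U \<Phi> g gh \<longleftrightarrow>
     leray_cover (mtop M) I U \<and>
     (\<forall>i\<in>I. local_trivialization Y M G pr act (U i) (\<Phi> i)) \<and>
     (\<forall>i\<in>I. \<forall>j\<in>I. transition_function G (U i) (\<Phi> i) (U j) (\<Phi> j) (g i j)) \<and>
     (\<forall>i\<in>I. \<forall>j\<in>I.
        continuous_map (subtopology (mtop M) (U i \<inter> U j)) (mtop (mfd Gh)) (gh i j) \<and>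
        (\<forall>x\<in>U i \<inter> U j. \<rho> (gh i j x) = g i j x))"

text \<open>The kernel of the extension is identified with \<open>U(1)\<close> through \<open>\<iota>\<close>.\<close>
definition dixmier_douady_cocycle ::
  "('h, 'a) lie_group \<Rightarrow> (complex \<Rightarrow> 'h) \<Rightarrow> ('i \<Rightarrow> 'i \<Rightarrow> 'm \<Rightarrow> 'h) \<Rightarrow>
   'i list \<Rightarrow> 'm \<Rightarrow> complex" where
  "dixmier_douady_cocycle Gh \<iota> gh \<sigma> x =
     (let i = \<sigma> ! 0; j = \<sigma> ! 1; k = \<sigma> ! 2 in
        inv_into (carrier U1) \<iota> (gh j k x \<otimes>\<^bsub>Gh\<^esub> inv\<^bsub>Gh\<^esub> (gh i k x) \<otimes>\<^bsub>Gh\<^esub> gh i j x))"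

definition dixmier_douady_class ::
  "('h, 'a) lie_group \<Rightarrow> (complex \<Rightarrow> 'h) \<Rightarrow> 'm topology \<Rightarrow> 'i set \<Rightarrow> ('i \<Rightarrow> 'm set) \<Rightarrow>
   ('i \<Rightarrow> 'i \<Rightarrow> 'm \<Rightarrow> 'h) \<Rightarrow> ('m, int) cech_rep set" where
  "dixmier_douady_class Gh \<iota> X I U gh =
     exp_connecting X
       (cech_class X U1 (mtop (mfd U1)) 2 I U (dixmier_douady_cocycle Gh \<iota> gh))"

end

theory Submission
  imports Defs
begin

text \<open>The bundle is given by two sets of trivializations: the \<open>\<Phi> i\<close> over the \<open>U i\<close>, from which the
  Dixmier--Douady cocycle is formed, and flat ones, whose transition functions \<open>\<gamma>\<close> are locally
  constant. Composing \<open>\<gamma>\<close> with an arbitrary set-theoretic section of \<open>\<rho>\<close> yields locally constant lifts,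
  and their failure to be a cocycle is a locally constant \<open>U(1)\<close>-valued cocycle. The change of frame
  between the two trivializations at a point lifts to the extension near that point, because
  \<open>\<rho>\<close> has continuous local sections. Comparing the lifts, one finds that on a fine enough pointed cover
  the Dixmier--Douady cocycle is \<open>cis (2 \<pi> t) \<cdot> \<delta> e\<close>, where \<open>t\<close> is a locally constant real cochain and
  \<open>e\<close> a continuous circle-valued cochain (\<open>flat_cocycle_decomposition\<close>).

  Let \<open>n = \<delta> b\<close> be an integral cocycle that represents the class, \<open>cis (2 \<pi> b)\<close> being cohomologous to
  the Dixmier--Douady cocycle, so that again \<open>cis (2 \<pi> b) = cis (2 \<pi> t) \<cdot> \<delta> e\<close> for some \<open>e\<close>. If
  \<open>e = cis (2 \<pi> f)\<close> for a continuous real cochain \<open>f\<close>, then \<open>R = b - \<delta> f\<close> is continuous and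
  \<open>cis (2 \<pi> R)\<close> is locally constant, so \<open>R\<close> is a locally constant real cochain with \<open>\<delta> R = n\<close>. Hence \<open>n\<close>
  vanishes over the reals (\<open>coboundary_of_exp_flat_cochain_is_trivial\<close>).

  The logarithm \<open>f\<close> is where the topology of \<open>M\<close> enters. Each \<open>e [x, y]\<close> has logarithms locally, but
  a neighbourhood of \<open>x\<close> meets the members of a pointed cover that belong to infinitely many points,
  and it cannot be made small with regard to all of them. So a countable locally finite refinement is
  used, and with it a map \<open>r\<close> on the indices that is not the identity
  (\<open>pointed_cover_controlling_overlaps\<close>); the manifold is regular and Lindeloef, so there is one. Pulling
  the cocycle back along \<open>r\<close> changes it by the coboundary of an explicit prism cochain
  (\<open>reindexing_homotopy_eq\<close>).\<close>

section \<open>Regularity of finite-dimensional manifolds\<close>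

text \<open>By induction on the spanning set. If \<open>b\<close> is not in the span of \<open>B\<close>, which is closed by the induction
  hypothesis, then \<open>b\<close> has positive distance \<open>d\<close> from it. This bounds the coefficient of \<open>b\<close> in \<open>x n\<close>
  by \<open>norm (x n) / d\<close>, and subsequences can be chosen for the two components separately.\<close>
lemma bounded_sequence_in_finite_span:
  fixes B :: "'a::real_normed_vector set" and x :: "nat \<Rightarrow> 'a"
  assumes "finite B" and "range x \<subseteq> span B" and "bounded (range x)"
  shows "\<exists>l\<in>span B. \<exists>s::nat \<Rightarrow> nat. strict_mono s \<and> (x \<circ> s) \<longlonglongrightarrow> l"
  using assms
proof (induction B arbitrary: x rule: finite_induct)
  case empty
  then have "x = (\<lambda>n. 0)" by (auto simp: fun_eq_iff)
  then show ?case
    by (intro bexI[of _ 0] exI[of _ id]) (auto simp: strict_mono_def)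
next
  case (insert b B)
  show ?case
  proof (cases "b \<in> span B")
    case True
    then have "span (insert b B) = span B" by (rule span_redundant)
    then show ?thesis using insert by simp
  next
    case False
    have clo: "closed (span B)"
      unfolding closed_sequential_limits
    proof (intro allI impI)
      fix z l assume z: "(\<forall>n. z n \<in> span B) \<and> z \<longlonglongrightarrow> l"
      then have "bounded (range z)"
        by (meson convergent_def convergent_imp_bounded)
      with z insert.IH[of z] obtain l' s where
        l': "l' \<in> span B" "strict_mono s" "(z \<circ> s) \<longlonglongrightarrow> l'" by blast
      have "(z \<circ> s) \<longlonglongrightarrow> l" using z l'(2) LIMSEQ_subseq_LIMSEQ by blast
      then show "l \<in> span B" using l' LIMSEQ_unique by blast
    qed
    have ne: "span B \<noteq> {}" using span_zero by blast
    define d where "d = infdist b (span B)"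
    have "d > 0"
      using in_closed_iff_infdist_zero[OF clo ne, of b] False infdist_nonneg[of b "span B"]
      unfolding d_def by linarith
    have "\<exists>t. x n - t *\<^sub>R b \<in> span B" for n
      using insert.prems(1) span_breakdown_eq[of "x n" b B] by blast
    then obtain t where t: "x n - t n *\<^sub>R b \<in> span B" for n by metis
    obtain K where K: "norm (x n) \<le> K" for n
      using insert.prems(2) unfolding bounded_iff by auto
    have tb: "\<bar>t n\<bar> \<le> K / d" for n
    proof (cases "t n = 0")
      case True
      then show ?thesis using \<open>d > 0\<close> order_trans[OF norm_ge_zero K[of n]] by simp
    next
      case False
      have "(-1 / t n) *\<^sub>R (x n - t n *\<^sub>R b) \<in> span B" using t span_scale by blast
      then have "d \<le> dist b ((-1 / t n) *\<^sub>R (x n - t n *\<^sub>R b))"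
        unfolding d_def by (rule infdist_le)
      also have "\<dots> = norm ((1 / t n) *\<^sub>R x n)"
        using False by (simp add: dist_norm algebra_simps)
      also have "\<dots> \<le> K / \<bar>t n\<bar>"
        using K[of n] by (simp add: divide_right_mono)
      finally show ?thesis using False \<open>d > 0\<close> by (simp add: field_simps)
    qed
    have "bounded (range t)" unfolding bounded_iff using tb by auto
    then obtain l1 s1 where s1: "strict_mono s1" "(t \<circ> s1) \<longlonglongrightarrow> l1"
      using bounded_imp_convergent_subsequence by blast
    define y where "y = (\<lambda>n. x (s1 n) - t (s1 n) *\<^sub>R b)"
    have "norm (y n) \<le> K + K / d * norm b" for n
    proof -
      have "norm (y n) \<le> norm (x (s1 n)) + \<bar>t (s1 n)\<bar> * norm b"
        unfolding y_def by (metis norm_scaleR norm_triangle_ineq4)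
      also have "\<dots> \<le> K + K / d * norm b"
        by (intro add_mono K mult_right_mono tb) auto
      finally show ?thesis .
    qed
    then have "bounded (range y)" unfolding bounded_iff by auto
    moreover have "range y \<subseteq> span B" using t unfolding y_def by auto
    ultimately obtain l2 s2 where s2: "l2 \<in> span B" "strict_mono s2" "(y \<circ> s2) \<longlonglongrightarrow> l2"
      using insert.IH[of y] by blast
    have "(\<lambda>n. (y \<circ> s2) n + ((t \<circ> s1) \<circ> s2) n *\<^sub>R b) \<longlonglongrightarrow> l2 + l1 *\<^sub>R b"
      by (intro tendsto_intros s2 LIMSEQ_subseq_LIMSEQ[OF s1(2) s2(2)])
    then have "(x \<circ> (s1 \<circ> s2)) \<longlonglongrightarrow> l2 + l1 *\<^sub>R b"
      by (simp add: y_def o_def)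
    moreover have "l2 + l1 *\<^sub>R b \<in> span (insert b B)"
      using s2(1) span_mono[of B "insert b B"] span_base[of b "insert b B"]
      by (metis insertI1 span_add span_scale subsetD subset_insertI)
    ultimately show ?thesis using strict_mono_o[OF s1(1) s2(2)] by blast
  qed
qed

lemma finite_dimensional_imp_locally_compact:
  assumes "finite_dimensional TYPE('e::real_normed_vector)"
  shows "locally_compact_space (euclidean :: 'e topology)"
proof -
  obtain B :: "'e set" where B: "finite B" "span B = UNIV"
    using assms unfolding finite_dimensional_def by blast
  have "compact (cball x 1)" for x :: 'e
    unfolding compact_def
  proof (intro allI impI)
    fix f :: "nat \<Rightarrow> 'e" assume f: "\<forall>n. f n \<in> cball x 1"
    then have "bounded (range f)" using bounded_subset[OF bounded_cball] by blast
    then obtain l s where "strict_mono s" "(f \<circ> s) \<longlonglongrightarrow> l"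
      using bounded_sequence_in_finite_span[OF B(1)] B(2) by blast
    moreover have "l \<in> cball x 1"
      using closed_sequentially[OF closed_cball _ \<open>(f \<circ> s) \<longlonglongrightarrow> l\<close>] f by simp
    ultimately show "\<exists>l\<in>cball x 1. \<exists>r. strict_mono r \<and> (f \<circ> r) \<longlonglongrightarrow> l" by blast
  qed
  then show ?thesis
    unfolding locally_compact_space_def
    by (metis ball_subset_cball centre_in_ball compactin_euclidean_iff open_ball open_openin zero_less_one)
qed

text \<open>Charts transfer local compactness to the manifold. The Hausdorff property alone would not
  suffice: a closed ball in a chart need not be closed in a manifold unless it is compact.\<close>
lemma finite_dim_manifold_regular:
  fixes X :: "('m, 'e::real_normed_vector) manifold"
  assumes "is_finite_dim_manifold X"
  shows "regular_space (mtop X)"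
proof -
  have sm: "is_smooth_manifold X" and fd: "finite_dimensional TYPE('e)"
    using assms by (auto simp: is_finite_dim_manifold_def)
  have hausdorff: "Hausdorff_space (mtop X)" using sm by (simp add: is_smooth_manifold_def)
  have "locally_compact_space (mtop X)"
    unfolding locally_compact_space_def
  proof
    fix x assume "x \<in> topspace (mtop X)"
    then have "x \<in> \<Union> (fst ` atlas X)" using sm unfolding is_smooth_manifold_def by simp
    then obtain U \<phi> where U: "(U, \<phi>) \<in> atlas X" "x \<in> U" by auto
    then have *: "openin (mtop X) U" "open (\<phi> ` U)"
       "homeomorphic_map (subtopology (mtop X) U) (top_of_set (\<phi> ` U)) \<phi>"
      using sm unfolding is_smooth_manifold_def by auto
    have "locally_compact_space (top_of_set (\<phi> ` U))"
      using finite_dimensional_imp_locally_compact[OF fd] *(2)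
      by (intro locally_compact_space_open_subset) (auto simp: Hausdorff_space_euclidean)
    then have "locally_compact_space (subtopology (mtop X) U)"
      using *(3) homeomorphic_locally_compact_space homeomorphic_map_imp_homeomorphic_space by blast
    moreover have "x \<in> topspace (subtopology (mtop X) U)"
      using U *(1) openin_subset by auto
    ultimately obtain V K where "openin (subtopology (mtop X) U) V"
      "compactin (subtopology (mtop X) U) K" "x \<in> V" "V \<subseteq> K"
      unfolding locally_compact_space_def by blast
    then show "\<exists>V K. openin (mtop X) V \<and> compactin (mtop X) K \<and> x \<in> V \<and> V \<subseteq> K"
      using *(1) by (auto simp: compactin_subtopology openin_open_subtopology)
  qed
  with hausdorff show ?thesis by (rule locally_compact_Hausdorff_imp_regular_space[rotated])
qed

section \<open>Cech cochains with real, integral and circle coefficients\<close>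

lemma simplices_1: "\<sigma> \<in> simplices I (Suc 0) \<longleftrightarrow> (\<exists>x y. \<sigma> = [x, y] \<and> x \<in> I \<and> y \<in> I)"
  by (auto simp: simplices_def length_Suc_conv)

lemma simplices_2: "\<sigma> \<in> simplices I 2 \<longleftrightarrow> (\<exists>x y z. \<sigma> = [x, y, z] \<and> x \<in> I \<and> y \<in> I \<and> z \<in> I)"
  by (auto simp: simplices_def length_Suc_conv numeral_2_eq_2)

lemma simplices_3: "\<sigma> \<in> simplices I 3 \<longleftrightarrow>
    (\<exists>x y z w. \<sigma> = [x, y, z, w] \<and> x \<in> I \<and> y \<in> I \<and> z \<in> I \<and> w \<in> I)"
  by (auto simp: simplices_def length_Suc_conv numeral_3_eq_3)

lemma simplices_4: "\<sigma> \<in> simplices I 4 \<longleftrightarrow>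
    (\<exists>x y z w v. \<sigma> = [x, y, z, w, v] \<and> x \<in> I \<and> y \<in> I \<and> z \<in> I \<and> w \<in> I \<and> v \<in> I)"
  by (auto simp: simplices_def length_Suc_conv eval_nat_numeral)

lemma supp_mono: "(\<And>i. i \<in> set \<sigma> \<Longrightarrow> U i \<subseteq> V i) \<Longrightarrow> supp U \<sigma> \<subseteq> supp V \<sigma>"
  by (auto simp: supp_def)

lemma cech_cochain_mono:
  assumes "cech_cochain X T p I U c" "\<And>i. i \<in> I \<Longrightarrow> V i \<subseteq> U i"
  shows "cech_cochain X T p I V c"
  unfolding cech_cochain_def
proof
  fix \<sigma> assume \<sigma>: "\<sigma> \<in> simplices I p"
  then have "supp V \<sigma> \<subseteq> supp U \<sigma>" using assms(2) by (intro supp_mono) (auto simp: simplices_def)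
  then show "continuous_map (subtopology X (supp V \<sigma>)) T (c \<sigma>)"
    using assms(1) \<sigma> unfolding cech_cochain_def by (meson continuous_map_from_subtopology_mono)
qed

lemma cech_cochain_reindex:
  assumes "cech_cochain X T p J U c" "\<And>i. i \<in> I \<Longrightarrow> r i \<in> J \<and> V i \<subseteq> U (r i)"
  shows "cech_cochain X T p I V (\<lambda>\<sigma>. c (map r \<sigma>))"
  unfolding cech_cochain_def
proof
  fix \<sigma> assume \<sigma>: "\<sigma> \<in> simplices I p"
  then have "supp V \<sigma> \<subseteq> supp U (map r \<sigma>)" "map r \<sigma> \<in> simplices J p"
    using assms(2) by (fastforce simp: simplices_def supp_def)+
  then show "continuous_map (subtopology X (supp V \<sigma>)) T (c (map r \<sigma>))"
    using assms(1) unfolding cech_cochain_def by (meson continuous_map_from_subtopology_mono)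
qed

lemma cech_diff_reindex: "cech_diff A (\<lambda>\<sigma>. c (map a \<sigma>)) \<sigma> x = cech_diff A c (map a \<sigma>) x"
  by (simp add: cech_diff_def take_map drop_map)

lemma cech_cocycle_reindex:
  assumes "cech_cocycle X A T p J U c" "\<And>i. i \<in> I \<Longrightarrow> r i \<in> J \<and> V i \<subseteq> U (r i)"
  shows "cech_cocycle X A T p I V (\<lambda>\<sigma>. c (map r \<sigma>))"
  unfolding cech_cocycle_def
proof (intro conjI ballI)
  show "cech_cochain X T p I V (\<lambda>\<sigma>. c (map r \<sigma>))"
    using assms by (intro cech_cochain_reindex[of X T p J U c]) (auto simp: cech_cocycle_def)
  fix \<sigma> x assume \<sigma>: "\<sigma> \<in> simplices I (Suc p)" "x \<in> supp V \<sigma>"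
  have "map r \<sigma> \<in> simplices J (Suc p)" "x \<in> supp U (map r \<sigma>)"
    using \<sigma> assms(2) by (fastforce simp: simplices_def supp_def)+
  then show "cech_diff A (\<lambda>\<sigma>. c (map r \<sigma>)) \<sigma> x = \<one>\<^bsub>A\<^esub>"
    using assms(1) by (simp add: cech_diff_reindex cech_cocycle_def)
qed

text \<open>Both the real and the integral coefficient group unfold to the record below.\<close>

lemma cech_diff_additive:
  fixes c :: "'i list \<Rightarrow> 'm \<Rightarrow> 'a::ab_group_add"
  shows "cech_diff \<lparr>carrier = UNIV, monoid.mult = (+), one = 0\<rparr> c \<sigma> x =
     (\<Sum>j<length \<sigma>. let y = c (take j \<sigma> @ drop (Suc j) \<sigma>) x in if even j then y else - y)"
proof -
  let ?A = "\<lparr>carrier = UNIV, monoid.mult = (+), one = 0\<rparr> :: 'a monoid"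
  interpret comm_group ?A
  proof (rule comm_groupI)
    show "\<exists>y\<in>carrier ?A. y \<otimes>\<^bsub>?A\<^esub> x = \<one>\<^bsub>?A\<^esub>" for x
      by (intro bexI[of _ "- x"]) auto
  qed (auto simp: algebra_simps)
  have "inv\<^bsub>?A\<^esub> y = - y" for y by (rule inv_equality) auto
  moreover have "finprod ?A f S = sum f S" if "finite S" for f :: "nat \<Rightarrow> 'a" and S
    using that by (induction S rule: finite_induct) auto
  ultimately show ?thesis unfolding cech_diff_def by (simp add: Let_def cong: if_cong)
qed

lemmas cech_diff_real = cech_diff_additive[where 'a = real, folded real_group_def]
lemmas cech_diff_int = cech_diff_additive[where 'a = int, folded integer_group_def]

lemma cech_diff_real_of_int:
  "cech_diff real_group (\<lambda>\<sigma> x. real_of_int (c \<sigma> x)) \<sigma> x = real_of_int (cech_diff integer_group c \<sigma> x)"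
  unfolding cech_diff_real cech_diff_int of_int_sum by (intro sum.cong) (auto simp: Let_def)

lemma cech_diff_real_add:
  "cech_diff real_group (\<lambda>\<sigma> x. b \<sigma> x + c \<sigma> x) \<sigma> x =
     cech_diff real_group b \<sigma> x + cech_diff real_group c \<sigma> x"
  unfolding cech_diff_real sum.distrib[symmetric] by (intro sum.cong) (auto simp: Let_def)

lemma cech_diff_real_minus:
  "cech_diff real_group (\<lambda>\<sigma> x. - b \<sigma> x) \<sigma> x = - cech_diff real_group b \<sigma> x"
  unfolding cech_diff_real sum_negf[symmetric] by (intro sum.cong) (auto simp: Let_def)

lemma cech_diff_real_triangle:
  "cech_diff real_group c [x, y, z] p = c [y, z] p - c [x, z] p + c [x, y] p"
  by (simp add: cech_diff_real lessThan_Suc)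

lemma cech_diff_real_tetrahedron:
  "cech_diff real_group c [x, y, z, w] p = c [y, z, w] p - c [x, z, w] p + c [x, y, w] p - c [x, y, z] p"
  by (simp add: cech_diff_real lessThan_Suc)

lemma cech_diff_real_4simplex:
  "cech_diff real_group c [x, y, z, w, v] p =
     c [y, z, w, v] p - c [x, z, w, v] p + c [x, y, w, v] p - c [x, y, z, v] p + c [x, y, z, w] p"
  by (simp add: cech_diff_real lessThan_Suc)

lemma U1_simps [simp]:
  "carrier U1 = sphere 0 1" "x \<otimes>\<^bsub>U1\<^esub> y = x * y" "\<one>\<^bsub>U1\<^esub> = 1" "mtop (mfd U1) = top_of_set (sphere 0 1)"
  by (simp_all add: U1_def)

lemma comm_group_U1: "comm_group U1"
proof (rule comm_groupI)
  show "\<exists>y\<in>carrier U1. y \<otimes>\<^bsub>U1\<^esub> x = \<one>\<^bsub>U1\<^esub>" if "x \<in> carrier U1" for x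
  proof
    have "x \<noteq> 0" using that by auto
    then show "inverse x \<otimes>\<^bsub>U1\<^esub> x = \<one>\<^bsub>U1\<^esub>" by simp
    show "inverse x \<in> carrier U1" using that by (simp add: norm_inverse)
  qed
qed (auto simp: norm_mult)

lemma cech_diff_circle:
  assumes "\<And>j. j < length \<sigma> \<Longrightarrow> norm (c (take j \<sigma> @ drop (Suc j) \<sigma>) x) = 1"
  shows "cech_diff U1 c \<sigma> x =
     (\<Prod>j<length \<sigma>. let y = c (take j \<sigma> @ drop (Suc j) \<sigma>) x in if even j then y else inverse y)"
proof -
  interpret comm_group U1 by (rule comm_group_U1)
  have inv: "inv\<^bsub>U1\<^esub> y = inverse y" if "norm y = 1" for y
  proof (rule inv_equality)
    have "y \<noteq> 0" using that by auto
    then show "inverse y \<otimes>\<^bsub>U1\<^esub> y = \<one>\<^bsub>U1\<^esub>" by simp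
  qed (use that in \<open>auto simp: norm_inverse\<close>)
  have prod: "finprod U1 f S = prod f S" if "finite S" "\<And>j. j \<in> S \<Longrightarrow> norm (f j) = 1"
    for f :: "nat \<Rightarrow> complex" and S
    using that
  proof (induction S rule: finite_induct)
    case (insert j S)
    then show ?case by (subst finprod_insert) auto
  next
    case empty
    show ?case using finprod_empty by simp
  qed
  have "cech_diff U1 c \<sigma> x = finprod U1
     (\<lambda>j. let y = c (take j \<sigma> @ drop (Suc j) \<sigma>) x in if even j then y else inverse y) {..<length \<sigma>}"
    unfolding cech_diff_def
    by (rule finprod_cong) (auto simp: Let_def inv assms norm_inverse simp_implies_def)
  also have "\<dots> = (\<Prod>j<length \<sigma>. let y = c (take j \<sigma> @ drop (Suc j) \<sigma>) x in if even j then y else inverse y)"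
    by (rule prod) (auto simp: Let_def assms norm_inverse)
  finally show ?thesis .
qed

lemma cech_diff_circle_triangle:
  assumes "norm (c [y, z] p) = 1" "norm (c [x, z] p) = 1" "norm (c [x, y] p) = 1"
  shows "cech_diff U1 c [x, y, z] p = c [y, z] p * inverse (c [x, z] p) * c [x, y] p"
  by (subst cech_diff_circle) (auto simp: lessThan_Suc less_Suc_eq assms)

lemma cech_diff_circle_tetrahedron:
  assumes "norm (c [y, z, w] p) = 1" "norm (c [x, z, w] p) = 1" "norm (c [x, y, w] p) = 1"
    "norm (c [x, y, z] p) = 1"
  shows "cech_diff U1 c [x, y, z, w] p =
     c [y, z, w] p * inverse (c [x, z, w] p) * c [x, y, w] p * inverse (c [x, y, z] p)"
  by (subst cech_diff_circle) (auto simp: lessThan_Suc less_Suc_eq assms)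

lemma cech_diff_circle_cis:
  "cech_diff U1 (\<lambda>\<sigma> x. cis (2 * pi * b \<sigma> x)) \<sigma> x = cis (2 * pi * cech_diff real_group b \<sigma> x)"
proof -
  have "(\<Prod>j\<in>S. cis (f j)) = cis (\<Sum>j\<in>S. f j)" if "finite S" for f :: "nat \<Rightarrow> real" and S
    using that by (induction S rule: finite_induct) (auto simp: cis_mult)
  moreover have "cech_diff U1 (\<lambda>\<sigma> x. cis (2 * pi * b \<sigma> x)) \<sigma> x =
     (\<Prod>j<length \<sigma>. cis (2 * pi * (let y = b (take j \<sigma> @ drop (Suc j) \<sigma>) x in if even j then y else - y)))"
    by (subst cech_diff_circle) (auto simp: Let_def cis_inverse intro!: prod.cong)
  ultimately show ?thesis
    by (simp add: cech_diff_real sum_distrib_left)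
qed

lemma cech_diff_real_diff:
  "cech_diff real_group (\<lambda>\<sigma> x. b \<sigma> x - c \<sigma> x) \<sigma> x =
     cech_diff real_group b \<sigma> x - cech_diff real_group c \<sigma> x"
  unfolding cech_diff_real sum_subtractf[symmetric] by (intro sum.cong) (auto simp: Let_def)

section \<open>Locally constant functions\<close>

lemma continuous_map_discreteI:
  assumes "\<And>x. x \<in> topspace X \<Longrightarrow> f x \<in> A"
    and "\<And>x. x \<in> topspace X \<Longrightarrow> \<exists>N. openin X N \<and> x \<in> N \<and> (\<forall>y\<in>N. f y = f x)"
  shows "continuous_map X (discrete_topology A) f"
proof -
  have "openin X {x \<in> topspace X. f x \<in> S}" for S
  proof (subst openin_subopen, intro ballI)
    fix x assume "x \<in> {x \<in> topspace X. f x \<in> S}"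
    then have x: "x \<in> topspace X" "f x \<in> S" by auto
    obtain N where N: "openin X N" "x \<in> N" "\<forall>y\<in>N. f y = f x" using assms(2)[OF x(1)] by blast
    then show "\<exists>T. openin X T \<and> x \<in> T \<and> T \<subseteq> {x \<in> topspace X. f x \<in> S}"
      using x(2) openin_subset[OF N(1)] by (metis (mono_tags, lifting) mem_Collect_eq subsetD subsetI)
  qed
  then show ?thesis using assms(1) by (auto simp: continuous_map_def)
qed

lemma continuous_map_discreteD:
  assumes f: "continuous_map X (discrete_topology A) f" and x: "x \<in> topspace X"
  shows "\<exists>N. openin X N \<and> x \<in> N \<and> (\<forall>y\<in>N. f y = f x)"
proof (intro exI conjI)
  have "f x \<in> A" using f x by (auto simp: continuous_map_def)
  then show "openin X {y \<in> topspace X. f y \<in> {f x}}"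
    by (intro openin_continuous_map_preimage[OF f]) auto
qed (use x in auto)

lemma continuous_map_discrete_combine:
  assumes f: "continuous_map X (discrete_topology A) f"
    and g: "continuous_map X (discrete_topology B) g"
    and "\<And>x. x \<in> topspace X \<Longrightarrow> F (f x) (g x) \<in> C"
  shows "continuous_map X (discrete_topology C) (\<lambda>x. F (f x) (g x))"
proof (rule continuous_map_discreteI)
  fix x assume x: "x \<in> topspace X"
  obtain N where N: "openin X N" "x \<in> N" "\<forall>y\<in>N. f y = f x"
    using continuous_map_discreteD[OF f x] by blast
  obtain N' where N': "openin X N'" "x \<in> N'" "\<forall>y\<in>N'. g y = g x"
    using continuous_map_discreteD[OF g x] by blast
  show "\<exists>N. openin X N \<and> x \<in> N \<and> (\<forall>y\<in>N. F (f y) (g y) = F (f x) (g x))"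
  proof (intro exI[of _ "N \<inter> N'"] conjI ballI)
    show "F (f y) (g y) = F (f x) (g x)" if "y \<in> N \<inter> N'" for y
    proof -
      have "f y = f x" using N(3) that by blast
      moreover have "g y = g x" using N'(3) that by blast
      ultimately show ?thesis by (rule arg_cong2)
    qed
    show "openin X (N \<inter> N')" using N(1) N'(1) by (rule openin_Int)
    show "x \<in> N \<inter> N'" using N(2) N'(2) by (rule IntI)
  qed
qed (rule assms(3))

lemma continuous_map_from_discrete:
  assumes "continuous_map X (discrete_topology A) f" "\<And>a. a \<in> A \<Longrightarrow> h a \<in> topspace Z"
  shows "continuous_map X Z (\<lambda>x. h (f x))"
proof -
  have "continuous_map (discrete_topology A) Z h" using assms(2) by auto
  from continuous_map_compose[OF assms(1) this] show ?thesis by (simp add: o_def)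
qed

text \<open>Two nearby values of a real function with the same image under \<open>\<lambda>s. cis (2 * pi * s)\<close> agree as soon
  as they differ by less than \<open>1\<close>.\<close>
lemma locally_constant_logarithm:
  assumes f: "continuous_map X euclideanreal f"
    and d: "continuous_map X (discrete_topology A) d"
    and fd: "\<And>x. x \<in> topspace X \<Longrightarrow> cis (2 * pi * f x) = d x"
  shows "continuous_map X (discrete_topology UNIV) f"
proof (rule continuous_map_discreteI)
  fix x assume x: "x \<in> topspace X"
  obtain N where N: "openin X N" "x \<in> N" "\<forall>y\<in>N. d y = d x"
    using continuous_map_discreteD[OF d x] by blast
  define N' where "N' = {y \<in> topspace X. f y \<in> ball (f x) 1}"
  have op: "openin X N'"
    unfolding N'_def by (rule openin_continuous_map_preimage[OF f]) simp
  have eq: "f y = f x" if "y \<in> N \<inter> N'" for y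
  proof -
    have y: "y \<in> topspace X" "y \<in> N" "\<bar>f y - f x\<bar> < 1"
      using that unfolding N'_def by (auto simp: dist_real_def)
    have "cis (2 * pi * f y) = cis (2 * pi * f x)"
      using fd[OF x] fd[OF y(1)] bspec[OF N(3) y(2)] by (simp only:)
    then have "cis (2 * pi * f y - 2 * pi * f x) = 1"
      unfolding cis_divide[symmetric] by simp
    then have "cos (2 * pi * f y - 2 * pi * f x) = 1" unfolding complex_eq_iff by simp
    then obtain k :: int where "2 * pi * f y - 2 * pi * f x = of_int k * 2 * pi"
      unfolding cos_one_2pi_int by blast
    then have "2 * pi * (f y - f x) = 2 * pi * of_int k" by (simp add: algebra_simps)
    then have k: "f y - f x = of_int k" by simp
    then have "k = 0" using y(3) by linarith
    then show ?thesis using k by simp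
  qed
  have "x \<in> N'" using x by (simp add: N'_def)
  show "\<exists>N. openin X N \<and> x \<in> N \<and> (\<forall>y\<in>N. f y = f x)"
  proof (intro exI[of _ "N \<inter> N'"] conjI ballI)
    show "f y = f x" if "y \<in> N \<inter> N'" for y using that by (rule eq)
    show "openin X (N \<inter> N')" using N(1) op by (rule openin_Int)
    show "x \<in> N \<inter> N'" using N(2) \<open>x \<in> N'\<close> by (rule IntI)
  qed
qed simp

section \<open>Lifting circle-valued cochains\<close>

text \<open>The principal branch of the argument is continuous on the right half-plane, so \<open>Arg (f y / f x)\<close>
  is continuous in \<open>y\<close> where the quotient has positive real part.\<close>
lemma local_angle_function:
  assumes f: "continuous_map (subtopology X S) (top_of_set (sphere 0 (1::real))) f"
    and S: "openin X S" "x \<in> S"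
  obtains N where "openin X N" "x \<in> N" "N \<subseteq> S"
    "\<exists>\<theta>. continuous_map (subtopology X N) euclideanreal \<theta> \<and> (\<forall>y\<in>N. cis (2 * pi * \<theta> y) = f y)"
proof -
  have S': "topspace (subtopology X S) = S" using S openin_subset by fastforce
  have fS: "norm (f y) = 1" if "y \<in> S" for y
    using f that unfolding continuous_map_in_subtopology S' by auto
  define P where "P = {z. 0 < Re (z / f x)}"
  have "open P" unfolding P_def by (intro open_Collect_less continuous_intros) (use fS[OF S(2)] in auto)
  define N where "N = {y \<in> S. f y \<in> P}"
  have fe: "continuous_map (subtopology X S) euclidean f"
    using f continuous_map_in_subtopology by blast
  have N: "openin X N"
    using openin_continuous_map_preimage[OF fe, of P] \<open>open P\<close> S(1)
    unfolding N_def S' by (simp add: openin_open_subtopology)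
  define \<theta> where "\<theta> = (\<lambda>y. (Arg (f y / f x) + Arg (f x)) / (2 * pi))"
  have "continuous_on P (\<lambda>z. (Arg (z / f x) + Arg (f x)) / (2 * pi))"
    using fS[OF S(2)] by (intro continuous_intros) (auto simp: P_def complex_nonpos_Reals_iff)
  moreover have "continuous_map (subtopology X N) (top_of_set P) f"
    using continuous_map_from_subtopology_mono[OF fe, of N]
    unfolding continuous_map_in_subtopology by (auto simp: N_def)
  ultimately have "continuous_map (subtopology X N) euclideanreal \<theta>"
    unfolding \<theta>_def
    using continuous_map_compose[of "subtopology X N" "top_of_set P" f euclideanreal
        "\<lambda>z. (Arg (z / f x) + Arg (f x)) / (2 * pi)"]
    by (simp add: o_def)
  moreover have "cis (2 * pi * \<theta> y) = f y" if "y \<in> N" for y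
  proof -
    have n: "norm (f y / f x) = 1" "norm (f x) = 1"
      using that fS S unfolding N_def by (auto simp: norm_divide)
    have "cis (Arg (f y / f x)) = f y / f x" "cis (Arg (f x)) = f x"
      using n cis_Arg[of "f y / f x"] cis_Arg[of "f x"] by (force simp: sgn_div_norm)+
    moreover have "2 * pi * \<theta> y = Arg (f y / f x) + Arg (f x)"
      by (simp add: \<theta>_def)
    ultimately have "cis (2 * pi * \<theta> y) = f y / f x * f x" by (simp add: cis_mult[symmetric])
    then show ?thesis using n(2) by auto
  qed
  moreover have "x \<in> N" unfolding N_def P_def using S fS[OF S(2)] by auto
  moreover have "N \<subseteq> S" unfolding N_def by auto
  ultimately show ?thesis using that N by blast
qed

lemma pointed_cover_subset:
  "pointed_cover X V \<Longrightarrow> x \<in> topspace X \<Longrightarrow> V x \<subseteq> topspace X"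
  by (simp add: openin_subset pointed_cover_def)

text \<open>A hereditary property \<open>Q i j N\<close> that holds for small neighbourhoods \<open>N\<close> of the points of
  \<open>W i \<inter> W j\<close> can be achieved for all overlaps of a single pointed cover, at the price of a change of
  indices \<open>r\<close>. The values of \<open>r\<close> are taken from a countable set \<open>q 0, q 1, \<dots>\<close> of points, around which
  there are neighbourhoods \<open>D \<subseteq> C \<subseteq> B \<subseteq> K \<subseteq> W\<close> with \<open>D\<close> and \<open>B\<close> open, \<open>C\<close> and \<open>K\<close> closed, and the sets
  \<open>D (q k)\<close> cover the space. With \<open>r x = q k\<close> for the first \<open>k\<close> such that \<open>x \<in> B (q k)\<close>, the set
  \<open>V x\<close> lies in some \<open>D (q j)\<close> and avoids \<open>C (q i)\<close> for all earlier \<open>i < k\<close>. Hence only the finitely many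
  indices \<open>q 0, \<dots>, q j\<close> matter at \<open>x\<close>, and \<open>V x\<close> can be chosen small for all of them: it satisfies \<open>Q\<close>
  for those with \<open>x \<in> K (q k)\<close>, and it misses \<open>K (q k)\<close>, hence all \<open>V y\<close> with \<open>r y = q k\<close>, for the rest.\<close>
lemma pointed_cover_controlling_overlaps:
  fixes X :: "'m topology" and Q :: "'m \<Rightarrow> 'm \<Rightarrow> 'm set \<Rightarrow> bool"
  assumes reg: "regular_space X" and lind: "Lindelof_space X"
    and W: "pointed_cover X W"
    and empty: "\<And>i j. Q i j {}"
    and hereditary: "\<And>i j N N'. Q i j N \<Longrightarrow> N' \<subseteq> N \<Longrightarrow> Q i j N'"
    and loc: "\<And>i j x. i \<in> topspace X \<Longrightarrow> j \<in> topspace X \<Longrightarrow> x \<in> W i \<inter> W j \<Longrightarrow>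
                \<exists>N. openin X N \<and> x \<in> N \<and> Q i j N"
  obtains V r where "pointed_cover X V"
    "\<And>x. x \<in> topspace X \<Longrightarrow> r x \<in> topspace X \<and> V x \<subseteq> W x \<inter> W (r x)"
    "\<And>x y. x \<in> topspace X \<Longrightarrow> y \<in> topspace X \<Longrightarrow> Q (r x) (r y) (V x \<inter> V y)"
proof (cases "topspace X = {}")
  case True
  then show ?thesis using that[of "\<lambda>_. {}" id] by (auto simp: pointed_cover_def)
next
  case False
  have shrink: "\<exists>N C. openin X N \<and> closedin X C \<and> x \<in> N \<and> N \<subseteq> C \<and> C \<subseteq> S"
    if "openin X S" "x \<in> S" for x S
  proof -
    have "neighbourhood_base_of (closedin X) X"
      using reg by (simp add: neighbourhood_base_of_closedin)
    then show ?thesis using that unfolding neighbourhood_base_of by meson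
  qed
  have "\<exists>D C B K. openin X D \<and> openin X B \<and> closedin X C \<and> closedin X K \<and>
          x \<in> D \<and> D \<subseteq> C \<and> C \<subseteq> B \<and> B \<subseteq> K \<and> K \<subseteq> W x" if "x \<in> topspace X" for x
  proof -
    have "openin X (W x)" "x \<in> W x" using W that by (auto simp: pointed_cover_def)
    then obtain B K where 1: "openin X B" "closedin X K" "x \<in> B" "B \<subseteq> K" "K \<subseteq> W x"
      using shrink by meson
    obtain D C where "openin X D" "closedin X C" "x \<in> D" "D \<subseteq> C" "C \<subseteq> B"
      using shrink[OF 1(1,3)] by meson
    with 1 show ?thesis by (intro exI[of _ D] exI[of _ C] exI[of _ B] exI[of _ K]) simp
  qed
  then obtain D C B K where DCBK: "\<And>x. x \<in> topspace X \<Longrightarrow>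
      openin X (D x) \<and> openin X (B x) \<and> closedin X (C x) \<and> closedin X (K x) \<and>
      x \<in> D x \<and> D x \<subseteq> C x \<and> C x \<subseteq> B x \<and> B x \<subseteq> K x \<and> K x \<subseteq> W x"
    by metis
  have Dop: "\<And>N. N \<in> D ` topspace X \<Longrightarrow> openin X N" using DCBK by auto
  have Dcov: "\<Union> (D ` topspace X) = topspace X"
    using DCBK openin_subset by fastforce
  have "\<exists>\<V>. countable \<V> \<and> \<V> \<subseteq> D ` topspace X \<and> \<Union> \<V> = topspace X"
    by (rule Lindelof_spaceD[OF lind _ Dcov]) (rule Dop)
  then obtain \<V> where \<V>: "countable \<V>" "\<V> \<subseteq> D ` topspace X" "\<Union> \<V> = topspace X"
    by (elim exE conjE)
  have "\<exists>S. countable S \<and> S \<subseteq> topspace X \<and> \<V> = D ` S"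
    using \<V>(1,2) by (simp flip: countable_subset_image)
  then obtain S where S: "countable S" "S \<subseteq> topspace X" "\<V> = D ` S" by metis
  have "S \<noteq> {}" using \<V>(3) S(3) False by (metis Union_empty image_empty)
  define q where "q = from_nat_into S"
  have q: "range q = S" using S(1) \<open>S \<noteq> {}\<close> by (simp add: q_def)
  then have qX: "q k \<in> topspace X" for k using S by auto
  have cover: "\<exists>k. x \<in> D (q k)" if "x \<in> topspace X" for x
    using \<V>(3) S(3) q that by auto
  (* a x is the position of r x in the sequence q, and j x bounds the positions that matter at x. *)
  define a where "a = (\<lambda>x. LEAST k. x \<in> B (q k))"
  define j where "j = (\<lambda>x. LEAST k. x \<in> D (q k))"
  have j: "x \<in> D (q (j x))" if "x \<in> topspace X" for x
    using cover[OF that] unfolding j_def by (rule LeastI_ex)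
  have a: "x \<in> B (q (a x))" if "x \<in> topspace X" for x
    unfolding a_def
  proof (rule LeastI_ex)
    show "\<exists>k. x \<in> B (q k)" using cover[OF that] DCBK qX by blast
  qed
  have a_least: "x \<notin> C (q k)" if "k < a x" for x k
    using not_less_Least[OF that[unfolded a_def]] DCBK[OF qX] by blast
  have xW: "x \<in> W (q (a x))" if "x \<in> topspace X" for x
    using a[OF that] DCBK[OF qX] by blast
  have "\<exists>N. openin X N \<and> x \<in> N \<and>
          (if x \<in> K (q k) then Q (q (a x)) (q k) N else N \<inter> K (q k) = {})"
    if "x \<in> topspace X" for x k
  proof (cases "x \<in> K (q k)")
    case True
    then have "x \<in> W (q (a x)) \<inter> W (q k)" using xW[OF that] DCBK[OF qX] by blast
    then show ?thesis using loc[OF qX qX] True by auto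
  next
    case False
    then show ?thesis
      using DCBK[OF qX] that by (intro exI[of _ "topspace X - K (q k)"]) auto
  qed
  then obtain N where N: "\<And>x k. x \<in> topspace X \<Longrightarrow> openin X (N x k) \<and> x \<in> N x k \<and>
          (if x \<in> K (q k) then Q (q (a x)) (q k) (N x k) else N x k \<inter> K (q k) = {})"
    by metis
  define V where "V = (\<lambda>x. W x \<inter> B (q (a x)) \<inter> D (q (j x)) \<inter>
     (topspace X - (\<Union>k<a x. C (q k))) \<inter> (\<Inter>k\<le>j x. N x k))"
  have "pointed_cover X V"
    unfolding pointed_cover_def V_def
    using W[unfolded pointed_cover_def] DCBK[OF qX] N a j a_least
    by (auto intro!: openin_Int openin_diff openin_INT2 closedin_Union)
  moreover have "q (a x) \<in> topspace X \<and> V x \<subseteq> W x \<inter> W (q (a x))" for x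
    using qX DCBK[OF qX] unfolding V_def by blast
  moreover have "Q (q (a x)) (q (a y)) (V x \<inter> V y)" if "x \<in> topspace X" "y \<in> topspace X" for x y
  proof (cases "V x \<inter> V y = {}")
    case True
    then show ?thesis using empty by simp
  next
    case False
    then obtain z where z: "z \<in> V x" "z \<in> V y" by blast
    have "a y \<le> j x"
    proof (rule ccontr)
      assume "\<not> a y \<le> j x"
      moreover have "z \<in> C (q (j x))" using z(1) DCBK[OF qX] unfolding V_def by blast
      ultimately show False using z(2) unfolding V_def by auto
    qed
    then have sub: "V x \<subseteq> N x (a y)" unfolding V_def by auto
    moreover have "z \<in> K (q (a y))" using z(2) DCBK[OF qX] unfolding V_def by blast
    ultimately have "Q (q (a x)) (q (a y)) (N x (a y))"
      using N[OF that(1), of "a y"] z(1) by (auto split: if_splits)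
    then show ?thesis using hereditary sub by blast
  qed
  ultimately show ?thesis using that[of V "q \<circ> a"] by auto
qed

lemma circle_cochain_lifts_after_reindexing:
  assumes reg: "regular_space X" and lind: "Lindelof_space X"
    and W: "pointed_cover X W"
    and e: "cech_cochain X (top_of_set (sphere 0 (1::real))) 1 (topspace X) W e"
  obtains V r f where "pointed_cover X V"
    "\<And>x. x \<in> topspace X \<Longrightarrow> r x \<in> topspace X \<and> V x \<subseteq> W x \<inter> W (r x)"
    "cech_cochain X euclideanreal 1 (topspace X) V f"
    "\<And>\<sigma> x. \<sigma> \<in> simplices (topspace X) 1 \<Longrightarrow> x \<in> supp V \<sigma> \<Longrightarrow>
        cis (2 * pi * f \<sigma> x) = e (map r \<sigma>) x"
proof -
  define Q where "Q = (\<lambda>i j N. \<exists>\<theta>. continuous_map (subtopology X N) euclideanreal \<theta> \<and>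
      (\<forall>y\<in>N. cis (2 * pi * \<theta> y) = e [i, j] y))"
  have her: "Q i j N'" if "Q i j N" "N' \<subseteq> N" for i j N N'
    using that unfolding Q_def by (meson continuous_map_from_subtopology_mono subsetD)
  have loc: "\<exists>N. openin X N \<and> x \<in> N \<and> Q i j N"
    if "i \<in> topspace X" "j \<in> topspace X" "x \<in> W i \<inter> W j" for i j x
  proof -
    have "[i, j] \<in> simplices (topspace X) 1" using that by (simp add: simplices_1)
    then have "continuous_map (subtopology X (W i \<inter> W j)) (top_of_set (sphere 0 1)) (e [i, j])"
      using e unfolding cech_cochain_def supp_def by force
    moreover have "openin X (W i \<inter> W j)" using W that by (simp add: pointed_cover_def openin_Int)
    ultimately show ?thesis using that(3) local_angle_function unfolding Q_def by metis
  qed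
  have emp: "Q i j {}" for i j by (simp add: Q_def continuous_map_def)
  obtain V r where V: "pointed_cover X V"
    "\<And>x. x \<in> topspace X \<Longrightarrow> r x \<in> topspace X \<and> V x \<subseteq> W x \<inter> W (r x)"
    "\<And>x y. x \<in> topspace X \<Longrightarrow> y \<in> topspace X \<Longrightarrow> Q (r x) (r y) (V x \<inter> V y)"
    using pointed_cover_controlling_overlaps[OF reg lind W, of Q] her loc emp by blast
  have "\<forall>\<sigma>. \<exists>\<theta>. \<sigma> \<in> simplices (topspace X) 1 \<longrightarrow>
     continuous_map (subtopology X (supp V \<sigma>)) euclideanreal \<theta> \<and>
      (\<forall>y\<in>supp V \<sigma>. cis (2 * pi * \<theta> y) = e (map r \<sigma>) y)"
    using V(3) unfolding Q_def by (fastforce simp: simplices_1 supp_def)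
  then obtain f where "\<forall>\<sigma>. \<sigma> \<in> simplices (topspace X) 1 \<longrightarrow>
     continuous_map (subtopology X (supp V \<sigma>)) euclideanreal (f \<sigma>) \<and>
      (\<forall>y\<in>supp V \<sigma>. cis (2 * pi * f \<sigma> y) = e (map r \<sigma>) y)"
    by metis
  then show ?thesis using that[of V r f] V(1,2) by (simp add: cech_cochain_def)
qed

section \<open>Real and integral cohomology classes\<close>

lemma cech_rel_Suc_iff:
  "((V, c), (V', c')) \<in> cech_rel X A T (Suc q) \<longleftrightarrow>
     (V, c) \<in> cech_reps X A T (Suc q) \<and> (V', c') \<in> cech_reps X A T (Suc q) \<and>
     (\<exists>W b. pointed_cover X W \<and> (\<forall>x\<in>topspace X. W x \<subseteq> V x \<inter> V' x) \<and>
        cech_cochain X T q (topspace X) W b \<and>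
        (\<forall>\<sigma>\<in>simplices (topspace X) (Suc q). \<forall>x\<in>supp W \<sigma>.
           c \<sigma> x = c' \<sigma> x \<otimes>\<^bsub>A\<^esub> cech_diff A b \<sigma> x))"
  by (simp add: cech_rel_def)

lemma real_group_mult [simp]: "x \<otimes>\<^bsub>real_group\<^esub> y = x + y"
  and real_group_one [simp]: "\<one>\<^bsub>real_group\<^esub> = 0"
  by (simp_all add: real_group_def)

lemma integer_group_mult [simp]: "x \<otimes>\<^bsub>integer_group\<^esub> y = x + y"
  and integer_group_one [simp]: "\<one>\<^bsub>integer_group\<^esub> = 0"
  by (simp_all add: integer_group_def)

lemma pointed_cover_Int:
  "pointed_cover X V \<Longrightarrow> pointed_cover X W \<Longrightarrow> pointed_cover X (\<lambda>x. V x \<inter> W x)"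
  by (auto simp: pointed_cover_def openin_Int)

abbreviation real_rel :: "'m topology \<Rightarrow> nat \<Rightarrow> ('m, real) cech_rep rel" where
  "real_rel X \<equiv> cech_rel X real_group (discrete_topology UNIV)"

lemma real_rel_sym:
  assumes "(p, p') \<in> real_rel X (Suc q)"
  shows "(p', p) \<in> real_rel X (Suc q)"
proof -
  obtain V c V' c' where p: "p = (V, c)" "p' = (V', c')" by fastforce
  obtain W b where reps: "(V, c) \<in> cech_reps X real_group (discrete_topology UNIV) (Suc q)"
      "(V', c') \<in> cech_reps X real_group (discrete_topology UNIV) (Suc q)"
    and W: "pointed_cover X W" "\<forall>x\<in>topspace X. W x \<subseteq> V x \<inter> V' x"
    and b: "cech_cochain X (discrete_topology UNIV) q (topspace X) W b"
    and eq: "\<forall>\<sigma>\<in>simplices (topspace X) (Suc q). \<forall>x\<in>supp W \<sigma>.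
        c \<sigma> x = c' \<sigma> x + cech_diff real_group b \<sigma> x"
    using assms unfolding p cech_rel_Suc_iff real_group_mult by auto
  have "cech_cochain X (discrete_topology UNIV) q (topspace X) W (\<lambda>\<sigma> x. - b \<sigma> x)"
    using b unfolding cech_cochain_def
    by (auto intro: continuous_map_from_discrete[where A = UNIV and h = uminus])
  moreover have "c' \<sigma> x = c \<sigma> x + cech_diff real_group (\<lambda>\<sigma> x. - b \<sigma> x) \<sigma> x"
    if "\<sigma> \<in> simplices (topspace X) (Suc q)" "x \<in> supp W \<sigma>" for \<sigma> x
    using eq that by (simp add: cech_diff_real_minus)
  moreover have "\<forall>x\<in>topspace X. W x \<subseteq> V' x \<inter> V x" using W(2) by blast
  ultimately show ?thesis
    unfolding p cech_rel_Suc_iff real_group_mult using reps W(1) by blast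
qed

lemma real_rel_trans:
  assumes "(p, p') \<in> real_rel X (Suc q)" "(p', p'') \<in> real_rel X (Suc q)"
  shows "(p, p'') \<in> real_rel X (Suc q)"
proof -
  obtain V c V' c' V'' c'' where p: "p = (V, c)" "p' = (V', c')" "p'' = (V'', c'')"
    by (metis surj_pair)
  obtain W b where reps: "(V, c) \<in> cech_reps X real_group (discrete_topology UNIV) (Suc q)"
    and W: "pointed_cover X W" "\<forall>x\<in>topspace X. W x \<subseteq> V x \<inter> V' x"
    and b: "cech_cochain X (discrete_topology UNIV) q (topspace X) W b"
    and eq: "\<forall>\<sigma>\<in>simplices (topspace X) (Suc q). \<forall>x\<in>supp W \<sigma>.
        c \<sigma> x = c' \<sigma> x + cech_diff real_group b \<sigma> x"
    using assms(1) unfolding p cech_rel_Suc_iff real_group_mult by auto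
  obtain W' b' where reps': "(V'', c'') \<in> cech_reps X real_group (discrete_topology UNIV) (Suc q)"
    and W': "pointed_cover X W'" "\<forall>x\<in>topspace X. W' x \<subseteq> V' x \<inter> V'' x"
    and b': "cech_cochain X (discrete_topology UNIV) q (topspace X) W' b'"
    and eq': "\<forall>\<sigma>\<in>simplices (topspace X) (Suc q). \<forall>x\<in>supp W' \<sigma>.
        c' \<sigma> x = c'' \<sigma> x + cech_diff real_group b' \<sigma> x"
    using assms(2) unfolding p cech_rel_Suc_iff real_group_mult by auto
  let ?W = "\<lambda>x. W x \<inter> W' x"
  have sup: "supp ?W \<sigma> \<subseteq> supp W \<sigma>" "supp ?W \<sigma> \<subseteq> supp W' \<sigma>" for \<sigma>
    by (auto simp: supp_def)
  have "cech_cochain X (discrete_topology UNIV) q (topspace X) ?W b"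
    "cech_cochain X (discrete_topology UNIV) q (topspace X) ?W b'"
    by (rule cech_cochain_mono[OF b], simp, rule cech_cochain_mono[OF b'], simp)
  then have "cech_cochain X (discrete_topology UNIV) q (topspace X) ?W (\<lambda>\<sigma> x. b \<sigma> x + b' \<sigma> x)"
    unfolding cech_cochain_def
    by (auto intro: continuous_map_discrete_combine[where A = UNIV and B = UNIV and F = "(+)"])
  moreover have "c \<sigma> x = c'' \<sigma> x + cech_diff real_group (\<lambda>\<sigma> x. b \<sigma> x + b' \<sigma> x) \<sigma> x"
    if "\<sigma> \<in> simplices (topspace X) (Suc q)" "x \<in> supp ?W \<sigma>" for \<sigma> x
  proof -
    have "c \<sigma> x = c' \<sigma> x + cech_diff real_group b \<sigma> x"
      "c' \<sigma> x = c'' \<sigma> x + cech_diff real_group b' \<sigma> x"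
      using eq eq' that sup by blast+
    then show ?thesis by (simp add: cech_diff_real_add)
  qed
  moreover have "\<forall>x\<in>topspace X. ?W x \<subseteq> V x \<inter> V'' x" using W(2) W'(2) by blast
  ultimately show ?thesis
    unfolding p cech_rel_Suc_iff real_group_mult
    using reps reps' pointed_cover_Int[OF W(1) W'(1)] by blast
qed

lemma integral_reps_imp_real_reps:
  assumes "(V, n) \<in> cech_reps X integer_group (discrete_topology UNIV) p"
  shows "(V, \<lambda>\<sigma> x. real_of_int (n \<sigma> x)) \<in> cech_reps X real_group (discrete_topology UNIV) p"
  using assms
  by (auto simp: cech_reps_def cech_cocycle_def cech_cochain_def cech_diff_real_of_int
      intro: continuous_map_from_discrete[where A = UNIV and h = real_of_int])

lemma integral_rel_imp_real_rel:
  assumes "((V, n), (V', n')) \<in> cech_rel X integer_group (discrete_topology UNIV) (Suc q)"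
  shows "((V, \<lambda>\<sigma> x. real_of_int (n \<sigma> x)), (V', \<lambda>\<sigma> x. real_of_int (n' \<sigma> x))) \<in> real_rel X (Suc q)"
proof -
  obtain W b where W: "pointed_cover X W" "\<forall>x\<in>topspace X. W x \<subseteq> V x \<inter> V' x"
    and b: "cech_cochain X (discrete_topology UNIV) q (topspace X) W b"
    and eq: "\<forall>\<sigma>\<in>simplices (topspace X) (Suc q). \<forall>x\<in>supp W \<sigma>.
        n \<sigma> x = n' \<sigma> x + cech_diff integer_group b \<sigma> x"
    using assms unfolding cech_rel_Suc_iff integer_group_mult by auto
  have "cech_cochain X (discrete_topology UNIV) q (topspace X) W (\<lambda>\<sigma> x. real_of_int (b \<sigma> x))"
    using b unfolding cech_cochain_def
    by (auto intro: continuous_map_from_discrete[where A = UNIV and h = real_of_int])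
  moreover have "real_of_int (n \<sigma> x) = real_of_int (n' \<sigma> x) +
      cech_diff real_group (\<lambda>\<sigma> x. real_of_int (b \<sigma> x)) \<sigma> x"
    if "\<sigma> \<in> simplices (topspace X) (Suc q)" "x \<in> supp W \<sigma>" for \<sigma> x
    using eq that by (simp add: cech_diff_real_of_int)
  moreover have "(V, n) \<in> cech_reps X integer_group (discrete_topology UNIV) (Suc q)"
    "(V', n') \<in> cech_reps X integer_group (discrete_topology UNIV) (Suc q)"
    using assms unfolding cech_rel_Suc_iff by simp_all
  ultimately show ?thesis
    unfolding cech_rel_Suc_iff real_group_mult using integral_reps_imp_real_reps W by blast
qed

lemma zero_in_real_reps:
  "(\<lambda>_. topspace X, \<lambda>_ _. 0) \<in> cech_reps X real_group (discrete_topology UNIV) p"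
  by (auto simp: cech_reps_def pointed_cover_def cech_cocycle_def cech_cochain_def cech_diff_real Let_def
      cong: if_cong)

lemma trivial_real_rep:
  assumes rep: "(V, n) \<in> cech_reps X real_group (discrete_topology UNIV) (Suc q)"
    and W: "pointed_cover X W" "\<And>x. x \<in> topspace X \<Longrightarrow> W x \<subseteq> V x"
    and h: "cech_cochain X (discrete_topology UNIV) q (topspace X) W h"
    and eq: "\<And>\<sigma> x. \<sigma> \<in> simplices (topspace X) (Suc q) \<Longrightarrow> x \<in> supp W \<sigma> \<Longrightarrow>
        n \<sigma> x = cech_diff real_group h \<sigma> x"
  shows "((V, n), (\<lambda>_. topspace X, \<lambda>_ _. 0)) \<in> real_rel X (Suc q)"
proof -
  have "\<forall>x\<in>topspace X. W x \<subseteq> V x \<inter> topspace X"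
    using W pointed_cover_subset[OF W(1)] by blast
  moreover have "\<forall>\<sigma>\<in>simplices (topspace X) (Suc q). \<forall>x\<in>supp W \<sigma>.
      n \<sigma> x = 0 + cech_diff real_group h \<sigma> x" using eq by simp
  ultimately show ?thesis
    unfolding cech_rel_Suc_iff real_group_mult using rep zero_in_real_reps W(1) h by blast
qed

section \<open>From a locally constant circle cocycle to a trivial real class\<close>

text \<open>The prism operator between the identity and the index map \<open>r\<close>, on \<open>3\<close>-cochains.\<close>
definition reindexing_homotopy :: "('i \<Rightarrow> 'i) \<Rightarrow> ('i list \<Rightarrow> 'm \<Rightarrow> real) \<Rightarrow> 'i list \<Rightarrow> 'm \<Rightarrow> real" where
  "reindexing_homotopy r n \<sigma> p =
     (let x = \<sigma> ! 0; y = \<sigma> ! 1; z = \<sigma> ! 2 in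
        n [x, r x, r y, r z] p - n [x, y, r y, r z] p + n [x, y, z, r z] p)"

text \<open>The four prism faces over the tetrahedron \<open>[x, y, z, w]\<close> are \<open>4\<close>-simplices, and \<open>n\<close> is a cocycle;
  adding the four cocycle conditions with alternating signs leaves the two ends of the prism.\<close>
lemma reindexing_homotopy_eq:
  assumes coc: "\<And>\<sigma>. \<sigma> \<in> simplices (insert x (insert y (insert z (insert w (r ` {x, y, z, w}))))) 4 \<Longrightarrow>
      cech_diff real_group n \<sigma> p = 0"
  shows "cech_diff real_group (reindexing_homotopy r n) [x, y, z, w] p =
     n [r x, r y, r z, r w] p - n [x, y, z, w] p"
proof -
  have "cech_diff real_group n [x, r x, r y, r z, r w] p = 0"
    "cech_diff real_group n [x, y, r y, r z, r w] p = 0"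
    "cech_diff real_group n [x, y, z, r z, r w] p = 0"
    "cech_diff real_group n [x, y, z, w, r w] p = 0"
    by (rule coc; simp add: simplices_def)+
  then show ?thesis
    by (simp add: cech_diff_real_4simplex cech_diff_real_tetrahedron reindexing_homotopy_def Let_def
        numeral_2_eq_2)
qed

text \<open>A logarithm \<open>f\<close> of \<open>e\<close> exists after a change of indices \<open>r\<close>. Then \<open>R = b \<circ> r - \<delta> f\<close> is continuous
  with \<open>cis (2 \<pi> R) = d \<circ> r\<close> and is thus locally constant, and \<open>\<delta> R\<close> is the pull-back of \<open>n\<close>
  along \<open>r\<close>. The prism cochain \<open>h\<close> accounts for the difference between \<open>n\<close> and this pull-back.\<close>
lemma coboundary_of_exp_flat_cochain_is_trivial:
  assumes reg: "regular_space X" and lind: "Lindelof_space X"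
    and rep: "(V, n) \<in> cech_reps X real_group (discrete_topology UNIV) 3"
    and b: "cech_cochain X euclideanreal 2 (topspace X) V b"
    and nb: "\<And>\<sigma> x. \<sigma> \<in> simplices (topspace X) 3 \<Longrightarrow> x \<in> supp V \<sigma> \<Longrightarrow>
        n \<sigma> x = cech_diff real_group b \<sigma> x"
    and W: "pointed_cover X W" "\<And>x. x \<in> topspace X \<Longrightarrow> W x \<subseteq> V x"
    and d: "cech_cochain X (discrete_topology A) 2 (topspace X) W d"
    and e: "cech_cochain X (top_of_set (sphere 0 1)) 1 (topspace X) W e"
    and bde: "\<And>\<sigma> x. \<sigma> \<in> simplices (topspace X) 2 \<Longrightarrow> x \<in> supp W \<sigma> \<Longrightarrow>
        cis (2 * pi * b \<sigma> x) = d \<sigma> x * cech_diff U1 e \<sigma> x"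
  shows "((V, n), (\<lambda>_. topspace X, \<lambda>_ _. 0)) \<in> real_rel X 3"
proof -
  let ?I = "topspace X"
  obtain V' r f where V': "pointed_cover X V'"
    and r: "\<And>x. x \<in> ?I \<Longrightarrow> r x \<in> ?I \<and> V' x \<subseteq> W x \<inter> W (r x)"
    and f: "cech_cochain X euclideanreal 1 ?I V' f"
    and fe: "\<And>\<sigma> x. \<sigma> \<in> simplices ?I 1 \<Longrightarrow> x \<in> supp V' \<sigma> \<Longrightarrow>
        cis (2 * pi * f \<sigma> x) = e (map r \<sigma>) x"
    using circle_cochain_lifts_after_reindexing[OF reg lind W(1) e] by metis
  have V'V: "V' x \<subseteq> V x \<inter> V (r x)" if "x \<in> ?I" for x
    using r[OF that] W(2)[of x] W(2)[of "r x"] that by blast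
  define R where "R = (\<lambda>\<sigma> p. b (map r \<sigma>) p - cech_diff real_group f \<sigma> p)"
  have R_cis: "cis (2 * pi * R \<sigma> p) = d (map r \<sigma>) p"
    if \<sigma>: "\<sigma> \<in> simplices ?I 2" and p: "p \<in> supp V' \<sigma>" for \<sigma> p
  proof -
    obtain x y z where xyz: "\<sigma> = [x, y, z]" "x \<in> ?I" "y \<in> ?I" "z \<in> ?I"
      using \<sigma> by (auto simp: simplices_2)
    have p': "p \<in> V' x" "p \<in> V' y" "p \<in> V' z" using p by (auto simp: xyz supp_def)
    have *: "e [r u, r v] p = cis (2 * pi * f [u, v] p)"
      if "u \<in> {x, y, z}" "v \<in> {x, y, z}" for u v
      using fe[of "[u, v]" p] that xyz p' by (auto simp: simplices_1 supp_def)
    have "map r \<sigma> \<in> simplices ?I 2" "p \<in> supp W (map r \<sigma>)"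
      using xyz p' r by (auto simp: simplices_2 supp_def)
    then have "cis (2 * pi * b (map r \<sigma>) p) = d (map r \<sigma>) p * cech_diff U1 e (map r \<sigma>) p"
      by (rule bde)
    also have "cech_diff U1 e (map r \<sigma>) p = cech_diff U1 (\<lambda>\<sigma> x. cis (2 * pi * f \<sigma> x)) \<sigma> p"
      unfolding xyz list.map by (simp add: cech_diff_circle_triangle *)
    also have "\<dots> = cis (2 * pi * cech_diff real_group f \<sigma> p)"
      by (rule cech_diff_circle_cis)
    finally have "cis (2 * pi * b (map r \<sigma>) p) / cis (2 * pi * cech_diff real_group f \<sigma> p) = d (map r \<sigma>) p"
      by simp
    then show ?thesis by (simp add: R_def right_diff_distrib cis_divide)
  qed
  have R_cont: "cech_cochain X (discrete_topology UNIV) 2 ?I V' R"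
    unfolding cech_cochain_def
  proof
    fix \<sigma> assume \<sigma>: "\<sigma> \<in> simplices ?I 2"
    then obtain x y z where xyz: "\<sigma> = [x, y, z]" "x \<in> ?I" "y \<in> ?I" "z \<in> ?I"
      by (auto simp: simplices_2)
    let ?S = "subtopology X (supp V' \<sigma>)"
    have "cech_cochain X euclideanreal 2 ?I V' (\<lambda>\<sigma>. b (map r \<sigma>))"
      by (rule cech_cochain_reindex[OF b]) (use r V'V in auto)
    then have 1: "continuous_map ?S euclideanreal (b (map r \<sigma>))"
      using \<sigma> unfolding cech_cochain_def by blast
    have 2: "continuous_map ?S euclideanreal (f [u, v])" if "u \<in> {x, y, z}" "v \<in> {x, y, z}" for u v
    proof -
      have "[u, v] \<in> simplices ?I 1" "supp V' \<sigma> \<subseteq> supp V' [u, v]"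
        using that xyz by (auto simp: simplices_1 supp_def)
      then show ?thesis
        using f unfolding cech_cochain_def by (meson continuous_map_from_subtopology_mono)
    qed
    have 3: "continuous_map ?S euclideanreal (R \<sigma>)"
      unfolding R_def cech_diff_real_triangle xyz(1)
      by (intro continuous_intros 2[unfolded xyz(1)] 1[unfolded xyz(1)]) auto
    have "cech_cochain X (discrete_topology A) 2 ?I V' (\<lambda>\<sigma>. d (map r \<sigma>))"
      by (rule cech_cochain_reindex[OF d]) (use r in auto)
    then have "continuous_map ?S (discrete_topology A) (d (map r \<sigma>))"
      using \<sigma> unfolding cech_cochain_def by blast
    then show "continuous_map ?S (discrete_topology UNIV) (R \<sigma>)"
      by (rule locally_constant_logarithm[OF 3]) (use R_cis[OF \<sigma>] in auto)
  qed
  have coc: "cech_diff real_group n \<sigma> p = 0" if "\<sigma> \<in> simplices ?I 4" "p \<in> supp V \<sigma>" for \<sigma> p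
    using rep that by (auto simp: cech_reps_def cech_cocycle_def)
  have n_cont: "cech_cochain X (discrete_topology UNIV) 3 ?I V n"
    using rep by (auto simp: cech_reps_def cech_cocycle_def)
  define h where "h = reindexing_homotopy r n"
  have h_cont: "cech_cochain X (discrete_topology UNIV) 2 ?I V' h"
    unfolding cech_cochain_def
  proof
    fix \<sigma> assume "\<sigma> \<in> simplices ?I 2"
    then obtain x y z where xyz: "\<sigma> = [x, y, z]" "x \<in> ?I" "y \<in> ?I" "z \<in> ?I"
      by (auto simp: simplices_2)
    let ?S = "subtopology X (supp V' \<sigma>)"
    have *: "continuous_map ?S (discrete_topology UNIV) (n \<tau>)"
      if "set \<tau> \<subseteq> {x, y, z, r x, r y, r z}" "length \<tau> = 4" for \<tau>
    proof -
      have sub: "V' x \<inter> V' y \<inter> V' z \<subseteq> V u \<and> u \<in> ?I" if "u \<in> {x, y, z, r x, r y, r z}" for u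
      proof -
        obtain v where v: "v \<in> {x, y, z}" "u = v \<or> u = r v" using \<open>u \<in> _\<close> by auto
        then have "v \<in> ?I" "V' x \<inter> V' y \<inter> V' z \<subseteq> V' v" using xyz(2-4) by auto
        then show ?thesis using v(2) r[of v] V'V[of v] by blast
      qed
      have "\<tau> \<in> simplices ?I 3" "supp V' \<sigma> \<subseteq> supp V \<tau>"
        using that sub by (auto simp: simplices_def supp_def xyz(1))
      then show ?thesis
        using n_cont unfolding cech_cochain_def by (meson continuous_map_from_subtopology_mono)
    qed
    have "continuous_map ?S (discrete_topology UNIV)
       (\<lambda>p. (n [x, r x, r y, r z] p - n [x, y, r y, r z] p) + n [x, y, z, r z] p)"
      by (intro continuous_map_discrete_combine[where A = UNIV and B = UNIV and F = "(+)"]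
          continuous_map_discrete_combine[where A = UNIV and B = UNIV and F = "(-)"] * UNIV_I) auto
    moreover have "h \<sigma> = (\<lambda>p. (n [x, r x, r y, r z] p - n [x, y, r y, r z] p) + n [x, y, z, r z] p)"
      by (auto simp: h_def reindexing_homotopy_def xyz(1))
    ultimately show "continuous_map ?S (discrete_topology UNIV) (h \<sigma>)" by simp
  qed
  have sum_cont: "cech_cochain X (discrete_topology UNIV) 2 ?I V' (\<lambda>\<sigma> p. R \<sigma> p - h \<sigma> p)"
    using R_cont h_cont unfolding cech_cochain_def
    by (auto intro!: continuous_map_discrete_combine[where A = UNIV and B = UNIV and F = "(-)"])
  have eq: "n \<sigma> p = cech_diff real_group (\<lambda>\<sigma> p. R \<sigma> p - h \<sigma> p) \<sigma> p"
    if \<sigma>: "\<sigma> \<in> simplices ?I 3" and p: "p \<in> supp V' \<sigma>" for \<sigma> p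
  proof -
    obtain x y z w where xyzw: "\<sigma> = [x, y, z, w]" "x \<in> ?I" "y \<in> ?I" "z \<in> ?I" "w \<in> ?I"
      using \<sigma> by (auto simp: simplices_3)
    have p': "p \<in> V' x" "p \<in> V' y" "p \<in> V' z" "p \<in> V' w" using p by (auto simp: xyzw supp_def)
    have verts: "u \<in> ?I \<and> p \<in> V u" if "u \<in> insert x (insert y (insert z (insert w (r ` {x, y, z, w}))))" for u
    proof -
      obtain v where v: "v \<in> {x, y, z, w}" "u = v \<or> u = r v" using \<open>u \<in> _\<close> by auto
      then have "v \<in> ?I" "p \<in> V' v" using xyzw(2-5) p' by auto
      then show ?thesis using v(2) r[of v] V'V[of v] by blast
    qed
    have "cech_diff real_group h \<sigma> p = n (map r \<sigma>) p - n \<sigma> p"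
      unfolding h_def xyzw(1) list.map
      by (rule reindexing_homotopy_eq, rule coc) (use verts in \<open>auto simp: simplices_def supp_def subset_eq\<close>)
    moreover have "n (map r \<sigma>) p = cech_diff real_group b (map r \<sigma>) p"
      by (rule nb) (use xyzw verts in \<open>auto simp: simplices_3 supp_def\<close>)
    moreover have "cech_diff real_group R \<sigma> p = cech_diff real_group b (map r \<sigma>) p"
      by (simp add: xyzw(1) R_def cech_diff_real_tetrahedron cech_diff_real_triangle)
    ultimately show ?thesis
      by (simp add: cech_diff_real_diff)
  qed
  show ?thesis
    using trivial_real_rep[of V n X 2 V' "\<lambda>\<sigma> p. R \<sigma> p - h \<sigma> p"] rep V' V'V sum_cont eq
    by (simp add: numeral_3_eq_3 numeral_2_eq_2)
qed

lemma integral_coboundary_of_locally_constant: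
  assumes t: "cech_cochain X (discrete_topology UNIV) 2 I W t"
    and int: "\<forall>\<sigma>\<in>simplices I 3. \<forall>x\<in>supp W \<sigma>. cis (2 * pi * cech_diff real_group t \<sigma> x) = 1"
  defines "n \<equiv> \<lambda>\<sigma> x. \<lfloor>cech_diff real_group t \<sigma> x\<rfloor>"
  shows "\<And>\<sigma> x. \<sigma> \<in> simplices I 3 \<Longrightarrow> x \<in> supp W \<sigma> \<Longrightarrow> real_of_int (n \<sigma> x) = cech_diff real_group t \<sigma> x"
    and "cech_cocycle X integer_group (discrete_topology UNIV) 3 I W n"
proof -
  show eq: "real_of_int (n \<sigma> x) = cech_diff real_group t \<sigma> x"
    if "\<sigma> \<in> simplices I 3" "x \<in> supp W \<sigma>" for \<sigma> x
  proof -
    have "cos (2 * pi * cech_diff real_group t \<sigma> x) = 1"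
      using bspec[OF bspec[OF int that(1)] that(2)] unfolding complex_eq_iff by simp
    then obtain k :: int where "2 * pi * cech_diff real_group t \<sigma> x = of_int k * 2 * pi"
      unfolding cos_one_2pi_int by blast
    then have "2 * pi * cech_diff real_group t \<sigma> x = 2 * pi * of_int k" by (simp add: algebra_simps)
    then have "cech_diff real_group t \<sigma> x = of_int k" by simp
    then show ?thesis by (simp add: n_def)
  qed
  show "cech_cocycle X integer_group (discrete_topology UNIV) 3 I W n"
    unfolding cech_cocycle_def
  proof (intro conjI ballI)
    show "cech_cochain X (discrete_topology UNIV) 3 I W n"
      unfolding cech_cochain_def
    proof
      fix \<sigma> assume \<sigma>: "\<sigma> \<in> simplices I 3"
      then obtain x y z w where xyzw: "\<sigma> = [x, y, z, w]" "x \<in> I" "y \<in> I" "z \<in> I" "w \<in> I"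
        by (auto simp: simplices_3)
      let ?S = "subtopology X (supp W \<sigma>)"
      have *: "continuous_map ?S (discrete_topology UNIV) (t \<tau>)"
        if "set \<tau> \<subseteq> set \<sigma>" "length \<tau> = 3" for \<tau>
      proof -
        have "\<tau> \<in> simplices I 2" "supp W \<sigma> \<subseteq> supp W \<tau>"
          using that xyzw by (auto simp: simplices_def supp_def)
        then show ?thesis
          using t unfolding cech_cochain_def by (meson continuous_map_from_subtopology_mono)
      qed
      have "continuous_map ?S (discrete_topology UNIV)
         (\<lambda>p. (t [y, z, w] p - t [x, z, w] p) + (t [x, y, w] p - t [x, y, z] p))"
        by (intro continuous_map_discrete_combine[where A = UNIV and B = UNIV and F = "(+)"]
          continuous_map_discrete_combine[where A = UNIV and B = UNIV and F = "(-)"] * UNIV_I)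
          (auto simp: xyzw(1))
      then have "continuous_map ?S (discrete_topology UNIV) (cech_diff real_group t \<sigma>)"
        unfolding xyzw(1) cech_diff_real_tetrahedron[abs_def] by (simp add: algebra_simps)
      then show "continuous_map ?S (discrete_topology UNIV) (n \<sigma>)"
        unfolding n_def by (rule continuous_map_from_discrete) simp
    qed
    fix \<sigma> p assume "\<sigma> \<in> simplices I (Suc 3)" and p: "p \<in> supp W \<sigma>"
    then have "\<sigma> \<in> simplices I 4" by simp
    then obtain x y z w v where
      \<sigma>: "\<sigma> = [x, y, z, w, v]" "x \<in> I" "y \<in> I" "z \<in> I" "w \<in> I" "v \<in> I"
      by (auto simp: simplices_4)
    have "real_of_int (n \<tau> p) = cech_diff real_group t \<tau> p"
      if "set \<tau> \<subseteq> set \<sigma>" "length \<tau> = 4" for \<tau>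
      using that \<sigma> p by (intro eq) (auto simp: simplices_def supp_def)
    then have "cech_diff real_group (\<lambda>\<sigma> x. real_of_int (n \<sigma> x)) \<sigma> p = 0"
      unfolding \<sigma>(1) cech_diff_real_4simplex by (simp add: cech_diff_real_tetrahedron)
    then show "cech_diff integer_group n \<sigma> p = \<one>\<^bsub>integer_group\<^esub>"
      by (simp add: cech_diff_real_of_int)
  qed
qed

lemma exp_locally_constant_in_circle_reps:
  assumes W: "pointed_cover X W"
    and t: "cech_cochain X (discrete_topology UNIV) 2 (topspace X) W t"
    and int: "\<forall>\<sigma>\<in>simplices (topspace X) 3. \<forall>x\<in>supp W \<sigma>.
        cis (2 * pi * cech_diff real_group t \<sigma> x) = 1"
  shows "(W, \<lambda>\<sigma> x. cis (2 * pi * t \<sigma> x)) \<in> cech_reps X U1 (mtop (mfd U1)) 2"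
  unfolding cech_reps_def cech_cocycle_def cech_cochain_def mem_Collect_eq prod.case
proof (intro conjI ballI)
  show "continuous_map (subtopology X (supp W \<sigma>)) (mtop (mfd U1)) (\<lambda>x. cis (2 * pi * t \<sigma> x))"
    if "\<sigma> \<in> simplices (topspace X) 2" for \<sigma>
  proof (rule continuous_map_from_discrete[where A = UNIV and f = "t \<sigma>" and h = "\<lambda>y. cis (2 * pi * y)"])
    show "continuous_map (subtopology X (supp W \<sigma>)) (discrete_topology UNIV) (t \<sigma>)"
      using t that by (simp add: cech_cochain_def)
  qed simp
  show "cech_diff U1 (\<lambda>\<sigma> x. cis (2 * pi * t \<sigma> x)) \<sigma> x = \<one>\<^bsub>U1\<^esub>"
    if "\<sigma> \<in> simplices (topspace X) (Suc 2)" "x \<in> supp W \<sigma>" for \<sigma> x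
    using int that by (simp add: cech_diff_circle_cis)
qed (fact W)

section \<open>Local trivializations and transition functions\<close>

lemma lie_group_topology:
  assumes "is_lie_group G"
  shows "group G" "topspace (mtop (mfd G)) = carrier G"
    "\<And>f h X. continuous_map X (mtop (mfd G)) f \<Longrightarrow> continuous_map X (mtop (mfd G)) h \<Longrightarrow>
       continuous_map X (mtop (mfd G)) (\<lambda>x. f x \<otimes>\<^bsub>G\<^esub> h x)"
    "\<And>f X. continuous_map X (mtop (mfd G)) f \<Longrightarrow>
       continuous_map X (mtop (mfd G)) (\<lambda>x. inv\<^bsub>G\<^esub> f x)"
proof -
  show "group G" "topspace (mtop (mfd G)) = carrier G"
    using assms by (auto simp: is_lie_group_def)
  have mult: "continuous_map (prod_topology (mtop (mfd G)) (mtop (mfd G))) (mtop (mfd G)) (\<lambda>(x, y). x \<otimes>\<^bsub>G\<^esub> y)"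
    and inv: "continuous_map (mtop (mfd G)) (mtop (mfd G)) (\<lambda>x. inv\<^bsub>G\<^esub> x)"
    using assms by (auto simp: is_lie_group_def smooth_map_def prod_manifold_def)
  show "continuous_map X (mtop (mfd G)) (\<lambda>x. f x \<otimes>\<^bsub>G\<^esub> h x)"
    if "continuous_map X (mtop (mfd G)) f" "continuous_map X (mtop (mfd G)) h" for X f h
    using continuous_map_compose[OF continuous_map_pairedI[OF that] mult] by (simp add: o_def)
  show "continuous_map X (mtop (mfd G)) (\<lambda>x. inv\<^bsub>G\<^esub> f x)"
    if "continuous_map X (mtop (mfd G)) f" for X f
    using continuous_map_compose[OF that inv] by (simp add: o_def)
qed

text \<open>The inverse of a trivialization is continuous; \<open>\<kappa>\<close> is its second component.\<close>
lemma local_trivialization_fibre_coordinate: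
  assumes triv: "local_trivialization Y M G pr act U \<Phi>"
    and top: "topspace (mtop (mfd G)) = carrier G"
  obtains \<kappa> where
    "continuous_map (subtopology (mtop Y) {p \<in> topspace (mtop Y). pr p \<in> U}) (mtop (mfd G)) \<kappa>"
    "\<And>x g. x \<in> U \<Longrightarrow> g \<in> carrier G \<Longrightarrow> \<kappa> (\<Phi> (x, g)) = g"
    "\<And>p. p \<in> topspace (mtop Y) \<Longrightarrow> pr p \<in> U \<Longrightarrow> \<kappa> p \<in> carrier G \<and> \<Phi> (pr p, \<kappa> p) = p"
proof -
  let ?P = "prod_topology (subtopology (mtop M) U) (mtop (mfd G))"
  let ?Q = "subtopology (mtop Y) {p \<in> topspace (mtop Y). pr p \<in> U}"
  have UM: "U \<subseteq> topspace (mtop M)" using triv by (simp add: local_trivialization_def openin_subset)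
  have P: "topspace ?P = U \<times> carrier G" using UM top by auto
  have Q: "topspace ?Q = {p \<in> topspace (mtop Y). pr p \<in> U}" by auto
  have bij: "bij_betw \<Phi> (topspace ?P) (topspace ?Q)"
    and inv: "continuous_map ?Q ?P (inv_into (topspace ?P) \<Phi>)"
    using triv unfolding local_trivialization_def diffeomorphism_def smooth_map_def
    by (auto simp: prod_manifold_def open_submanifold_def)
  have pr: "pr (\<Phi> (x, g)) = x" if "x \<in> U" "g \<in> carrier G" for x g
    using triv that by (simp add: local_trivialization_def)
  define \<kappa> where "\<kappa> = (\<lambda>p. snd (inv_into (topspace ?P) \<Phi> p))"
  have "continuous_map ?Q (mtop (mfd G)) \<kappa>"
    using continuous_map_compose[OF inv continuous_map_snd] by (simp add: o_def \<kappa>_def)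
  moreover have "\<kappa> (\<Phi> (x, g)) = g" if "x \<in> U" "g \<in> carrier G" for x g
    using bij_betw_inv_into_left[OF bij, of "(x, g)"] that unfolding P \<kappa>_def by simp
  moreover have "\<kappa> p \<in> carrier G \<and> \<Phi> (pr p, \<kappa> p) = p" if "p \<in> topspace (mtop Y)" "pr p \<in> U" for p
  proof -
    have p: "p \<in> topspace ?Q" using that by simp
    obtain x g where xg: "inv_into (topspace ?P) \<Phi> p = (x, g)" by fastforce
    then have "(x, g) \<in> U \<times> carrier G" "\<Phi> (x, g) = p"
      using bij_betw_inv_into_right[OF bij p] bij_betw_apply[OF bij_betw_inv_into[OF bij] p] unfolding P
      by auto
    then show ?thesis using pr[of x g] xg unfolding \<kappa>_def by auto
  qed
  ultimately show ?thesis using that by blast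
qed

lemma local_trivialization_in_total_space:
  assumes triv: "local_trivialization Y M G pr act U \<Phi>"
    and top: "topspace (mtop (mfd G)) = carrier G" and "x \<in> U" "g \<in> carrier G"
  shows "\<Phi> (x, g) \<in> topspace (mtop Y)" "pr (\<Phi> (x, g)) = x"
proof -
  have "U \<subseteq> topspace (mtop M)" using triv by (simp add: local_trivialization_def openin_subset)
  then have "(x, g) \<in> topspace (mtop (prod_manifold (open_submanifold M U) (mfd G)))"
    using assms(3,4) top by (auto simp: prod_manifold_def open_submanifold_def)
  then have "\<Phi> (x, g) \<in> topspace (mtop (open_submanifold Y {p \<in> topspace (mtop Y). pr p \<in> U}))"
    using triv unfolding local_trivialization_def diffeomorphism_def by (meson bij_betw_apply)
  then show "\<Phi> (x, g) \<in> topspace (mtop Y)" by (auto simp: open_submanifold_def)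
  show "pr (\<Phi> (x, g)) = x" using triv assms(3,4) by (simp add: local_trivialization_def)
qed

lemma local_trivialization_continuous_section:
  assumes triv: "local_trivialization Y M G pr act U \<Phi>"
    and top: "topspace (mtop (mfd G)) = carrier G" and g: "g \<in> carrier G"
  shows "continuous_map (subtopology (mtop M) U) (mtop Y) (\<lambda>x. \<Phi> (x, g))"
proof -
  have cont: "continuous_map (prod_topology (subtopology (mtop M) U) (mtop (mfd G))) (mtop Y) \<Phi>"
    using triv unfolding local_trivialization_def diffeomorphism_def smooth_map_def
    by (auto simp: prod_manifold_def open_submanifold_def continuous_map_in_subtopology)
  have "continuous_map (subtopology (mtop M) U)
      (prod_topology (subtopology (mtop M) U) (mtop (mfd G))) (\<lambda>x. (x, g))"
    using g top by (intro continuous_map_pairedI) auto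
  from continuous_map_compose[OF this cont] show ?thesis by (simp add: o_def)
qed

lemma local_trivialization_inj:
  assumes "local_trivialization Y M G pr act U \<Phi>" "topspace (mtop (mfd G)) = carrier G"
    and "x \<in> U" "g \<in> carrier G" "h \<in> carrier G" "\<Phi> (x, g) = \<Phi> (x, h)"
  shows "g = h"
proof -
  obtain \<kappa> where
    "continuous_map (subtopology (mtop Y) {p \<in> topspace (mtop Y). pr p \<in> U}) (mtop (mfd G)) \<kappa>"
    and \<kappa>: "\<And>x g. x \<in> U \<Longrightarrow> g \<in> carrier G \<Longrightarrow> \<kappa> (\<Phi> (x, g)) = g"
    and "\<And>p. p \<in> topspace (mtop Y) \<Longrightarrow> pr p \<in> U \<Longrightarrow> \<kappa> p \<in> carrier G \<and> \<Phi> (pr p, \<kappa> p) = p"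
    by (rule local_trivialization_fibre_coordinate[OF assms(1,2)]) (rule that)
  have "g = \<kappa> (\<Phi> (x, g))" using \<kappa>[OF assms(3,4)] by (rule sym)
  also have "\<dots> = h" unfolding assms(6) by (rule \<kappa>[OF assms(3,5)])
  finally show ?thesis .
qed

lemma continuous_transition_function_exists:
  assumes G: "is_lie_group G"
    and U: "local_trivialization Y M G pr act U \<Phi>"
    and V: "local_trivialization Y M G pr act V \<Psi>"
  obtains k where "continuous_map (subtopology (mtop M) (U \<inter> V)) (mtop (mfd G)) k"
    "transition_function G U \<Phi> V \<Psi> k"
proof -
  interpret group G using lie_group_topology(1)[OF G] .
  note top = lie_group_topology(2)[OF G]
  obtain \<kappa> where \<kappa>: "continuous_map (subtopology (mtop Y) {p \<in> topspace (mtop Y). pr p \<in> U}) (mtop (mfd G)) \<kappa>"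
    "\<And>x g. x \<in> U \<Longrightarrow> g \<in> carrier G \<Longrightarrow> \<kappa> (\<Phi> (x, g)) = g"
    "\<And>p. p \<in> topspace (mtop Y) \<Longrightarrow> pr p \<in> U \<Longrightarrow> \<kappa> p \<in> carrier G \<and> \<Phi> (pr p, \<kappa> p) = p"
    by (rule local_trivialization_fibre_coordinate[OF U top]) (rule that)
  define k where "k = (\<lambda>x. \<kappa> (\<Psi> (x, \<one>\<^bsub>G\<^esub>)))"
  note tot = local_trivialization_in_total_space[OF V top]
  have "continuous_map (subtopology (mtop M) (U \<inter> V)) (mtop Y) (\<lambda>x. \<Psi> (x, \<one>\<^bsub>G\<^esub>))"
    using local_trivialization_continuous_section[OF V top one_closed]
    by (rule continuous_map_from_subtopology_mono) simp
  then have "continuous_map (subtopology (mtop M) (U \<inter> V))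
      (subtopology (mtop Y) {p \<in> topspace (mtop Y). pr p \<in> U}) (\<lambda>x. \<Psi> (x, \<one>\<^bsub>G\<^esub>))"
    using tot by (auto simp: continuous_map_in_subtopology)
  from continuous_map_compose[OF this \<kappa>(1)]
  have "continuous_map (subtopology (mtop M) (U \<inter> V)) (mtop (mfd G)) k"
    by (simp add: k_def o_def)
  moreover have "transition_function G U \<Phi> V \<Psi> k"
    unfolding transition_function_def
  proof (intro ballI conjI)
    fix x assume x: "x \<in> U \<inter> V"
    have *: "k x \<in> carrier G \<and> \<Phi> (x, k x) = \<Psi> (x, \<one>\<^bsub>G\<^esub>)"
      using \<kappa>(3)[OF tot(1)] tot(2) x unfolding k_def by auto
    then show "k x \<in> carrier G" by blast
    fix h assume h: "h \<in> carrier G"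
    have "\<Psi> (x, \<one>\<^bsub>G\<^esub> \<otimes>\<^bsub>G\<^esub> h) = act (\<Psi> (x, \<one>\<^bsub>G\<^esub>)) h"
      using V x h unfolding local_trivialization_def by blast
    moreover have "\<Phi> (x, k x \<otimes>\<^bsub>G\<^esub> h) = act (\<Phi> (x, k x)) h"
      using U x h * unfolding local_trivialization_def by blast
    ultimately show "\<Psi> (x, h) = \<Phi> (x, k x \<otimes>\<^bsub>G\<^esub> h)" using * h by simp
  qed
  ultimately show ?thesis using that by blast
qed

text \<open>Both products describe \<open>\<Xi>\<close> in terms of \<open>\<Phi>\<close>, and a trivialization is injective on fibres.\<close>
lemma transition_function_compose:
  assumes G: "is_lie_group G"
    and triv: "local_trivialization Y M G pr act U \<Phi>"
    and "transition_function G U \<Phi> V \<Psi> g" "transition_function G V \<Psi> W \<Xi> h"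
    and "transition_function G U \<Phi> V' \<Psi>' g'" "transition_function G V' \<Psi>' W \<Xi> h'"
    and x: "x \<in> U" "x \<in> V" "x \<in> V'" "x \<in> W"
  shows "g x \<otimes>\<^bsub>G\<^esub> h x = g' x \<otimes>\<^bsub>G\<^esub> h' x"
proof -
  interpret group G using lie_group_topology(1)[OF G] .
  note top = lie_group_topology(2)[OF G]
  have c: "g x \<in> carrier G" "h x \<in> carrier G" "g' x \<in> carrier G" "h' x \<in> carrier G"
    using assms by (auto simp: transition_function_def)
  have "\<Phi> (x, g x \<otimes>\<^bsub>G\<^esub> h x) = \<Xi> (x, \<one>\<^bsub>G\<^esub>)"
    using assms(3,4) x c by (simp add: transition_function_def)
  moreover have "\<Phi> (x, g' x \<otimes>\<^bsub>G\<^esub> h' x) = \<Xi> (x, \<one>\<^bsub>G\<^esub>)"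
    using assms(5,6) x c by (simp add: transition_function_def)
  ultimately show ?thesis
    using local_trivialization_inj[OF triv top x(1)] c by simp
qed

lemma transition_function_cocycle:
  assumes G: "is_lie_group G"
    and triv: "local_trivialization Y M G pr act U \<Phi>"
    and "transition_function G U \<Phi> V \<Psi> g" "transition_function G V \<Psi> W \<Xi> h"
    and "transition_function G U \<Phi> W \<Xi> f"
    and x: "x \<in> U" "x \<in> V" "x \<in> W"
  shows "g x \<otimes>\<^bsub>G\<^esub> h x = f x"
proof -
  interpret group G using lie_group_topology(1)[OF G] .
  have "transition_function G W \<Xi> W \<Xi> (\<lambda>_. \<one>\<^bsub>G\<^esub>)" by (simp add: transition_function_def)
  from transition_function_compose[OF G triv assms(3,4) assms(5) this] x
  have "g x \<otimes>\<^bsub>G\<^esub> h x = f x \<otimes>\<^bsub>G\<^esub> \<one>\<^bsub>G\<^esub>" by simp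
  then show ?thesis using assms(5) x by (simp add: transition_function_def)
qed

section \<open>Lifting cocycles through a central extension\<close>

locale circle_extension =
  fixes Gh :: "('h, 'a::locally_convex_space) lie_group"
    and G :: "('g, 'f::locally_convex_space) lie_group"
    and \<iota> :: "complex \<Rightarrow> 'h" and \<rho> :: "'h \<Rightarrow> 'g"
  assumes extension: "central_extension Gh G \<iota> \<rho>"
begin

lemma lie_groups: "is_lie_group Gh" "is_lie_group G"
  using extension by (simp_all add: central_extension_def)

sublocale Gh: group Gh using lie_groups(1) by (rule lie_group_topology)
sublocale G: group G using lie_groups(2) by (rule lie_group_topology)
sublocale rho: group_hom Gh G \<rho>
  by unfold_locales (use extension in \<open>simp add: central_extension_def\<close>)

lemmas Gh_top = lie_group_topology(2)[OF lie_groups(1)]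
lemmas G_top = lie_group_topology(2)[OF lie_groups(2)]

lemma iota_closed: "norm z = 1 \<Longrightarrow> \<iota> z \<in> carrier Gh"
  using extension unfolding central_extension_def hom_def by auto

lemma iota_mult: "norm z = 1 \<Longrightarrow> norm w = 1 \<Longrightarrow> \<iota> (z * w) = \<iota> z \<otimes>\<^bsub>Gh\<^esub> \<iota> w"
  using extension unfolding central_extension_def hom_def by auto

lemma iota_inj: "norm z = 1 \<Longrightarrow> norm w = 1 \<Longrightarrow> \<iota> z = \<iota> w \<longleftrightarrow> z = w"
  using extension unfolding central_extension_def inj_on_def by auto

lemma iota_central: "norm z = 1 \<Longrightarrow> p \<in> carrier Gh \<Longrightarrow> \<iota> z \<otimes>\<^bsub>Gh\<^esub> p = p \<otimes>\<^bsub>Gh\<^esub> \<iota> z"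
  using extension unfolding central_extension_def by auto

lemma kernel_eq: "\<iota> ` sphere 0 1 = kernel Gh G \<rho>"
  using extension unfolding central_extension_def by auto

lemma extension_bundle: "principal_bundle (mfd Gh) (mfd G) U1 \<rho> (\<lambda>p z. p \<otimes>\<^bsub>Gh\<^esub> \<iota> z)"
  using extension by (simp add: central_extension_def)

lemma continuous_local_section:
  assumes "g \<in> carrier G"
  obtains N s where "openin (mtop (mfd G)) N" "g \<in> N"
    "continuous_map (subtopology (mtop (mfd G)) N) (mtop (mfd Gh)) s"
    "\<And>y. y \<in> N \<Longrightarrow> \<rho> (s y) = y"
proof -
  obtain N \<Phi> where N: "g \<in> N" and triv: "local_trivialization (mfd Gh) (mfd G) U1 \<rho> (\<lambda>p z. p \<otimes>\<^bsub>Gh\<^esub> \<iota> z) N \<Phi>"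
    using extension_bundle assms G_top unfolding principal_bundle_def by metis
  have top: "topspace (mtop (mfd U1)) = carrier U1" by simp
  show ?thesis
  proof (rule that[of N "\<lambda>y. \<Phi> (y, 1)"])
    show "openin (mtop (mfd G)) N" using triv by (simp add: local_trivialization_def)
    show "continuous_map (subtopology (mtop (mfd G)) N) (mtop (mfd Gh)) (\<lambda>y. \<Phi> (y, 1))"
      by (rule local_trivialization_continuous_section[OF triv top]) simp
    show "\<rho> (\<Phi> (y, 1)) = y" if "y \<in> N" for y
      by (rule local_trivialization_in_total_space[OF triv top that]) simp
  qed (fact N)
qed

text \<open>A trivialization of the extension over a neighbourhood of \<open>\<one>\<close> sends \<open>(\<one>, z)\<close> to \<open>p0 \<otimes> \<iota> z\<close>, where
  \<open>p0\<close> is the image of \<open>(\<one>, 1)\<close>. So its fibre coordinate, composed with the translation by \<open>p0\<close>,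
  inverts \<open>\<iota>\<close> on the kernel.\<close>
lemma continuous_map_iota_inverse:
  "continuous_map (subtopology (mtop (mfd Gh)) (kernel Gh G \<rho>)) (top_of_set (sphere 0 1))
     (inv_into (carrier U1) \<iota>)"
proof -
  obtain N \<Phi> where N: "\<one>\<^bsub>G\<^esub> \<in> N" and triv: "local_trivialization (mfd Gh) (mfd G) U1 \<rho> (\<lambda>p z. p \<otimes>\<^bsub>Gh\<^esub> \<iota> z) N \<Phi>"
    using extension_bundle G_top G.one_closed unfolding principal_bundle_def by metis
  have top: "topspace (mtop (mfd U1)) = carrier U1" by simp
  obtain \<kappa> where \<kappa>: "continuous_map (subtopology (mtop (mfd Gh)) {p \<in> topspace (mtop (mfd Gh)). \<rho> p \<in> N}) (mtop (mfd U1)) \<kappa>"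
    "\<And>x g. x \<in> N \<Longrightarrow> g \<in> carrier U1 \<Longrightarrow> \<kappa> (\<Phi> (x, g)) = g"
    "\<And>p. p \<in> topspace (mtop (mfd Gh)) \<Longrightarrow> \<rho> p \<in> N \<Longrightarrow> \<kappa> p \<in> carrier U1 \<and> \<Phi> (\<rho> p, \<kappa> p) = p"
    by (rule local_trivialization_fibre_coordinate[OF triv top]) (rule that)
  define p0 where "p0 = \<Phi> (\<one>\<^bsub>G\<^esub>, 1)"
  have p0: "p0 \<in> carrier Gh" "\<rho> p0 = \<one>\<^bsub>G\<^esub>"
    using local_trivialization_in_total_space[OF triv top N, of 1] Gh_top by (auto simp: p0_def)
  let ?K = "subtopology (mtop (mfd Gh)) (kernel Gh G \<rho>)"
  have "continuous_map ?K (mtop (mfd Gh)) (\<lambda>p. p0 \<otimes>\<^bsub>Gh\<^esub> p)"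
    by (rule lie_group_topology(3)[OF lie_groups(1)])
      (use p0 Gh_top in \<open>auto intro: continuous_map_from_subtopology\<close>)
  moreover have "p0 \<otimes>\<^bsub>Gh\<^esub> p \<in> carrier Gh \<and> \<rho> (p0 \<otimes>\<^bsub>Gh\<^esub> p) = \<one>\<^bsub>G\<^esub>" if "p \<in> kernel Gh G \<rho>" for p
    using that p0 by (simp add: kernel_def)
  ultimately have "continuous_map ?K (subtopology (mtop (mfd Gh)) {p \<in> topspace (mtop (mfd Gh)). \<rho> p \<in> N}) (\<lambda>p. p0 \<otimes>\<^bsub>Gh\<^esub> p)"
    using N Gh_top by (auto simp: continuous_map_in_subtopology)
  from continuous_map_compose[OF this \<kappa>(1)]
  have cont: "continuous_map ?K (top_of_set (sphere 0 1)) (\<lambda>p. \<kappa> (p0 \<otimes>\<^bsub>Gh\<^esub> p))" by (simp add: o_def)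
  show ?thesis
  proof (rule continuous_map_eq[OF cont])
    fix p assume "p \<in> topspace ?K"
    then have "p \<in> \<iota> ` sphere 0 1" using kernel_eq by auto
    then obtain z where z: "norm z = 1" "p = \<iota> z" by auto
    have "1 \<in> carrier U1" "z \<in> carrier U1" using z(1) by simp_all
    then have "\<Phi> (\<one>\<^bsub>G\<^esub>, 1 \<otimes>\<^bsub>U1\<^esub> z) = p0 \<otimes>\<^bsub>Gh\<^esub> \<iota> z"
      using triv N unfolding local_trivialization_def p0_def by blast
    then have "\<kappa> (p0 \<otimes>\<^bsub>Gh\<^esub> p) = z" using \<kappa>(2)[OF N, of z] z by simp
    moreover have "inv_into (carrier U1) \<iota> p = z"
      using extension z unfolding central_extension_def by (simp add: inv_into_f_f)
    ultimately show "\<kappa> (p0 \<otimes>\<^bsub>Gh\<^esub> p) = inv_into (carrier U1) \<iota> p" by simp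
  qed
qed

text \<open>If \<open>p\<close>, \<open>q\<close>, \<open>r\<close> lift elements \<open>g\<close>, \<open>h\<close>, \<open>g \<otimes> h\<close>, this measures by how much \<open>p \<otimes> q\<close> differs from \<open>r\<close>
  (\<open>mult_eq_defect\<close>). The order of the factors is the one in the Dixmier--Douady cocycle; since the
  product is central, cyclic permutations do not change it.\<close>
definition defect :: "'h \<Rightarrow> 'h \<Rightarrow> 'h \<Rightarrow> complex" where
  "defect p q r = inv_into (carrier U1) \<iota> (q \<otimes>\<^bsub>Gh\<^esub> inv\<^bsub>Gh\<^esub> r \<otimes>\<^bsub>Gh\<^esub> p)"

lemma in_kernel:
  assumes "p \<in> carrier Gh" "q \<in> carrier Gh" "r \<in> carrier Gh" "\<rho> p \<otimes>\<^bsub>G\<^esub> \<rho> q = \<rho> r"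
  shows "q \<otimes>\<^bsub>Gh\<^esub> inv\<^bsub>Gh\<^esub> r \<otimes>\<^bsub>Gh\<^esub> p \<in> kernel Gh G \<rho>"
proof -
  have "\<rho> (q \<otimes>\<^bsub>Gh\<^esub> inv\<^bsub>Gh\<^esub> r \<otimes>\<^bsub>Gh\<^esub> p) = \<rho> q \<otimes>\<^bsub>G\<^esub> inv\<^bsub>G\<^esub> (\<rho> p \<otimes>\<^bsub>G\<^esub> \<rho> q) \<otimes>\<^bsub>G\<^esub> \<rho> p"
    using assms by simp
  also have "\<dots> = \<one>\<^bsub>G\<^esub>"
    using assms(1,2) by (simp add: G.inv_mult_group G.m_assoc flip: G.m_assoc)
  finally show ?thesis using assms(1-3) by (simp add: kernel_def)
qed

lemma
  assumes "p \<in> carrier Gh" "q \<in> carrier Gh" "r \<in> carrier Gh" "\<rho> p \<otimes>\<^bsub>G\<^esub> \<rho> q = \<rho> r"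
  shows norm_defect: "norm (defect p q r) = 1"
    and mult_eq_defect: "p \<otimes>\<^bsub>Gh\<^esub> q = \<iota> (defect p q r) \<otimes>\<^bsub>Gh\<^esub> r"
proof -
  let ?k = "q \<otimes>\<^bsub>Gh\<^esub> inv\<^bsub>Gh\<^esub> r \<otimes>\<^bsub>Gh\<^esub> p"
  have "?k \<in> \<iota> ` carrier U1" using in_kernel[OF assms] kernel_eq by simp
  then have "defect p q r \<in> carrier U1" and k: "\<iota> (defect p q r) = ?k"
    unfolding defect_def by (rule inv_into_into, rule f_inv_into_f)
  then show n: "norm (defect p q r) = 1" by simp
  have "?k \<otimes>\<^bsub>Gh\<^esub> p = p \<otimes>\<^bsub>Gh\<^esub> ?k" using iota_central[OF n assms(1)] unfolding k .
  also have "\<dots> = (p \<otimes>\<^bsub>Gh\<^esub> q \<otimes>\<^bsub>Gh\<^esub> inv\<^bsub>Gh\<^esub> r) \<otimes>\<^bsub>Gh\<^esub> p"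
    using assms(1-3) by (simp add: Gh.m_assoc)
  finally have "?k = p \<otimes>\<^bsub>Gh\<^esub> q \<otimes>\<^bsub>Gh\<^esub> inv\<^bsub>Gh\<^esub> r" using assms(1-3) by (simp only: Gh.right_cancel Gh.m_closed Gh.inv_closed)
  then show "p \<otimes>\<^bsub>Gh\<^esub> q = \<iota> (defect p q r) \<otimes>\<^bsub>Gh\<^esub> r"
    unfolding k using assms(1-3) by (simp add: Gh.m_assoc)
qed

text \<open>Evaluate \<open>p01 \<otimes> p12 \<otimes> p23\<close> with both bracketings.\<close>
lemma defect_cocycle:
  assumes c: "p01 \<in> carrier Gh" "p12 \<in> carrier Gh" "p23 \<in> carrier Gh"
      "p02 \<in> carrier Gh" "p13 \<in> carrier Gh" "p03 \<in> carrier Gh"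
    and r: "\<rho> p01 \<otimes>\<^bsub>G\<^esub> \<rho> p12 = \<rho> p02" "\<rho> p12 \<otimes>\<^bsub>G\<^esub> \<rho> p23 = \<rho> p13"
      "\<rho> p01 \<otimes>\<^bsub>G\<^esub> \<rho> p13 = \<rho> p03" "\<rho> p02 \<otimes>\<^bsub>G\<^esub> \<rho> p23 = \<rho> p03"
  shows "defect p12 p23 p13 * inverse (defect p02 p23 p03) * defect p01 p13 p03 *
     inverse (defect p01 p12 p02) = 1"
proof -
  let ?a = "defect p12 p23 p13" and ?b = "defect p02 p23 p03"
    and ?c = "defect p01 p13 p03" and ?d = "defect p01 p12 p02"
  have n: "norm ?a = 1" "norm ?b = 1" "norm ?c = 1" "norm ?d = 1"
    using norm_defect c r by auto
  note i = iota_closed[OF n(1)] iota_closed[OF n(2)] iota_closed[OF n(3)] iota_closed[OF n(4)]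
  have "\<iota> (?d * ?b) \<otimes>\<^bsub>Gh\<^esub> p03 = \<iota> ?d \<otimes>\<^bsub>Gh\<^esub> (p02 \<otimes>\<^bsub>Gh\<^esub> p23)"
    using mult_eq_defect[OF c(4,3,6) r(4)] i c n by (simp add: iota_mult Gh.m_assoc)
  also have "\<dots> = (p01 \<otimes>\<^bsub>Gh\<^esub> p12) \<otimes>\<^bsub>Gh\<^esub> p23"
    using mult_eq_defect[OF c(1,2,4) r(1)] i c by (simp add: Gh.m_assoc)
  also have "\<dots> = p01 \<otimes>\<^bsub>Gh\<^esub> (\<iota> ?a \<otimes>\<^bsub>Gh\<^esub> p13)"
    using mult_eq_defect[OF c(2,3,5) r(2)] i c by (simp add: Gh.m_assoc)
  also have "\<dots> = \<iota> ?a \<otimes>\<^bsub>Gh\<^esub> (p01 \<otimes>\<^bsub>Gh\<^esub> p13)"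
    using iota_central[OF n(1) c(1)] i c by (simp flip: Gh.m_assoc)
  also have "\<dots> = \<iota> (?a * ?c) \<otimes>\<^bsub>Gh\<^esub> p03"
    using mult_eq_defect[OF c(1,5,6) r(3)] i c n by (simp add: iota_mult Gh.m_assoc)
  finally have "\<iota> (?d * ?b) = \<iota> (?a * ?c)"
    using i c n by (simp add: iota_mult)
  then have "?d * ?b = ?a * ?c" using n by (simp add: iota_inj norm_mult)
  moreover have "?b \<noteq> 0" "?d \<noteq> 0" "?a \<noteq> 0" "?c \<noteq> 0" using n by auto
  ultimately show ?thesis by (simp add: field_simps)
qed

text \<open>The elements \<open>s1\<close>, \<open>s2\<close>, \<open>s3\<close> arise from \<open>g1\<close>, \<open>g2\<close>, \<open>g3\<close> by the change of frame \<open>k1\<close>, \<open>k2\<close>, \<open>k3\<close>, which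
  holds in the extension only up to the defects on the right. The identity results from moving
  \<open>k1\<close> past \<open>g1 \<otimes> g2\<close> in one step, with \<open>g1 \<otimes> g2\<close> replaced by a multiple of \<open>g3\<close>, and in two steps.\<close>
lemma defect_change_of_frame:
  assumes c: "g1 \<in> carrier Gh" "g2 \<in> carrier Gh" "g3 \<in> carrier Gh"
      "s1 \<in> carrier Gh" "s2 \<in> carrier Gh" "s3 \<in> carrier Gh"
      "k1 \<in> carrier Gh" "k2 \<in> carrier Gh" "k3 \<in> carrier Gh"
    and r: "\<rho> g1 \<otimes>\<^bsub>G\<^esub> \<rho> g2 = \<rho> g3" "\<rho> s1 \<otimes>\<^bsub>G\<^esub> \<rho> s2 = \<rho> s3"
      "\<rho> k1 \<otimes>\<^bsub>G\<^esub> \<rho> g1 = \<rho> s1 \<otimes>\<^bsub>G\<^esub> \<rho> k2" "\<rho> k2 \<otimes>\<^bsub>G\<^esub> \<rho> g2 = \<rho> s2 \<otimes>\<^bsub>G\<^esub> \<rho> k3"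
      "\<rho> k1 \<otimes>\<^bsub>G\<^esub> \<rho> g3 = \<rho> s3 \<otimes>\<^bsub>G\<^esub> \<rho> k3"
  shows "defect g1 g2 g3 = defect s1 s2 s3 *
     (defect k2 g2 (s2 \<otimes>\<^bsub>Gh\<^esub> k3) * inverse (defect k1 g3 (s3 \<otimes>\<^bsub>Gh\<^esub> k3)) * defect k1 g1 (s1 \<otimes>\<^bsub>Gh\<^esub> k2))"
proof -
  let ?c = "defect g1 g2 g3" and ?d = "defect s1 s2 s3"
    and ?e12 = "defect k1 g1 (s1 \<otimes>\<^bsub>Gh\<^esub> k2)" and ?e23 = "defect k2 g2 (s2 \<otimes>\<^bsub>Gh\<^esub> k3)"
    and ?e13 = "defect k1 g3 (s3 \<otimes>\<^bsub>Gh\<^esub> k3)"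
  have n: "norm ?c = 1" "norm ?d = 1" "norm ?e12 = 1" "norm ?e23 = 1" "norm ?e13 = 1"
    using norm_defect c r by auto
  have eqs: "g1 \<otimes>\<^bsub>Gh\<^esub> g2 = \<iota> ?c \<otimes>\<^bsub>Gh\<^esub> g3" "s1 \<otimes>\<^bsub>Gh\<^esub> s2 = \<iota> ?d \<otimes>\<^bsub>Gh\<^esub> s3"
    "k1 \<otimes>\<^bsub>Gh\<^esub> g1 = \<iota> ?e12 \<otimes>\<^bsub>Gh\<^esub> (s1 \<otimes>\<^bsub>Gh\<^esub> k2)"
    "k2 \<otimes>\<^bsub>Gh\<^esub> g2 = \<iota> ?e23 \<otimes>\<^bsub>Gh\<^esub> (s2 \<otimes>\<^bsub>Gh\<^esub> k3)"
    "k1 \<otimes>\<^bsub>Gh\<^esub> g3 = \<iota> ?e13 \<otimes>\<^bsub>Gh\<^esub> (s3 \<otimes>\<^bsub>Gh\<^esub> k3)"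
    using mult_eq_defect c r by auto
  note i = iota_closed[OF n(1)] iota_closed[OF n(2)] iota_closed[OF n(3)] iota_closed[OF n(4)] iota_closed[OF n(5)]
  have "\<iota> (?c * ?e13) \<otimes>\<^bsub>Gh\<^esub> (s3 \<otimes>\<^bsub>Gh\<^esub> k3) = \<iota> ?c \<otimes>\<^bsub>Gh\<^esub> (k1 \<otimes>\<^bsub>Gh\<^esub> g3)"
    unfolding eqs(5) using i c n by (simp add: iota_mult Gh.m_assoc)
  also have "\<dots> = k1 \<otimes>\<^bsub>Gh\<^esub> (\<iota> ?c \<otimes>\<^bsub>Gh\<^esub> g3)"
    using iota_central[OF n(1) c(7)] i c by (simp flip: Gh.m_assoc)
  also have "\<dots> = (k1 \<otimes>\<^bsub>Gh\<^esub> g1) \<otimes>\<^bsub>Gh\<^esub> g2"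
    unfolding eqs(1)[symmetric] using c by (simp add: Gh.m_assoc)
  also have "\<dots> = \<iota> ?e12 \<otimes>\<^bsub>Gh\<^esub> (s1 \<otimes>\<^bsub>Gh\<^esub> (k2 \<otimes>\<^bsub>Gh\<^esub> g2))"
    unfolding eqs(3) using i c by (simp add: Gh.m_assoc)
  also have "\<dots> = \<iota> ?e12 \<otimes>\<^bsub>Gh\<^esub> (\<iota> ?e23 \<otimes>\<^bsub>Gh\<^esub> ((s1 \<otimes>\<^bsub>Gh\<^esub> s2) \<otimes>\<^bsub>Gh\<^esub> k3))"
    unfolding eqs(4) using iota_central[OF n(4) c(4)] i c by (simp add: Gh.m_assoc flip: Gh.m_assoc)
  also have "\<dots> = \<iota> (?e12 * (?e23 * ?d)) \<otimes>\<^bsub>Gh\<^esub> (s3 \<otimes>\<^bsub>Gh\<^esub> k3)"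
    unfolding eqs(2) using i c n by (simp add: iota_mult norm_mult Gh.m_assoc)
  finally have "\<iota> (?c * ?e13) = \<iota> (?e12 * (?e23 * ?d))"
    using i c n by (simp add: iota_mult norm_mult)
  then have "?c * ?e13 = ?e12 * (?e23 * ?d)" using n by (simp add: iota_inj norm_mult)
  moreover have "?e13 \<noteq> 0" using n by auto
  ultimately show ?thesis by (simp add: field_simps)
qed

lemma continuous_map_defect:
  assumes "continuous_map X (mtop (mfd Gh)) p" "continuous_map X (mtop (mfd Gh)) q"
    "continuous_map X (mtop (mfd Gh)) r"
    and rel: "\<And>x. x \<in> topspace X \<Longrightarrow> \<rho> (p x) \<otimes>\<^bsub>G\<^esub> \<rho> (q x) = \<rho> (r x)"
  shows "continuous_map X (top_of_set (sphere 0 1)) (\<lambda>x. defect (p x) (q x) (r x))"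
proof -
  have c: "p x \<in> carrier Gh" "q x \<in> carrier Gh" "r x \<in> carrier Gh" if "x \<in> topspace X" for x
    using assms(1-3) that Gh_top by (auto simp: continuous_map_def)
  have "continuous_map X (mtop (mfd Gh)) (\<lambda>x. q x \<otimes>\<^bsub>Gh\<^esub> inv\<^bsub>Gh\<^esub> (r x) \<otimes>\<^bsub>Gh\<^esub> p x)"
    by (intro lie_group_topology(3,4)[OF lie_groups(1)] assms)
  then have "continuous_map X (subtopology (mtop (mfd Gh)) (kernel Gh G \<rho>))
      (\<lambda>x. q x \<otimes>\<^bsub>Gh\<^esub> inv\<^bsub>Gh\<^esub> (r x) \<otimes>\<^bsub>Gh\<^esub> p x)"
    using in_kernel c rel by (auto simp: continuous_map_in_subtopology)
  from continuous_map_compose[OF this continuous_map_iota_inverse]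
  show ?thesis by (simp add: o_def defect_def)
qed

section \<open>The Dixmier--Douady cocycle of a flat bundle\<close>

lemma dixmier_douady_cocycle_eq_defect:
  "dixmier_douady_cocycle Gh \<iota> gh [i, j, k] x = defect (gh i j x) (gh j k x) (gh i k x)"
  by (simp add: dixmier_douady_cocycle_def defect_def Let_def numeral_2_eq_2)

lemma dixmier_douady_lifts:
  assumes data: "dixmier_douady_data Gh G \<rho> Y M pr act I U \<Phi> g gh"
  shows "\<And>i j x. i \<in> I \<Longrightarrow> j \<in> I \<Longrightarrow> x \<in> U i \<inter> U j \<Longrightarrow> gh i j x \<in> carrier Gh \<and> \<rho> (gh i j x) = g i j x"
    and "\<And>i j S. i \<in> I \<Longrightarrow> j \<in> I \<Longrightarrow> S \<subseteq> U i \<inter> U j \<Longrightarrow>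
       continuous_map (subtopology (mtop M) S) (mtop (mfd Gh)) (gh i j)"
    and "\<And>i j k x. i \<in> I \<Longrightarrow> j \<in> I \<Longrightarrow> k \<in> I \<Longrightarrow> x \<in> U i \<inter> U j \<inter> U k \<Longrightarrow>
       \<rho> (gh i j x) \<otimes>\<^bsub>G\<^esub> \<rho> (gh j k x) = \<rho> (gh i k x)"
proof -
  have triv: "local_trivialization Y M G pr act (U i) (\<Phi> i)" if "i \<in> I" for i
    using data that by (simp add: dixmier_douady_data_def)
  have tr: "transition_function G (U i) (\<Phi> i) (U j) (\<Phi> j) (g i j)" if "i \<in> I" "j \<in> I" for i j
    using data that by (simp add: dixmier_douady_data_def)
  have cont: "continuous_map (subtopology (mtop M) (U i \<inter> U j)) (mtop (mfd Gh)) (gh i j)"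
    if "i \<in> I" "j \<in> I" for i j
    using data that by (simp add: dixmier_douady_data_def)
  show lift: "gh i j x \<in> carrier Gh \<and> \<rho> (gh i j x) = g i j x"
    if "i \<in> I" "j \<in> I" "x \<in> U i \<inter> U j" for i j x
  proof
    show "\<rho> (gh i j x) = g i j x" using data that by (simp add: dixmier_douady_data_def)
    have "U i \<subseteq> topspace (mtop M)"
      using triv[OF that(1)] by (simp add: local_trivialization_def openin_subset)
    then have "x \<in> topspace (subtopology (mtop M) (U i \<inter> U j))" using that by auto
    then show "gh i j x \<in> carrier Gh"
      using cont[OF that(1,2)] Gh_top unfolding continuous_map_def by blast
  qed
  show "continuous_map (subtopology (mtop M) S) (mtop (mfd Gh)) (gh i j)"
    if "i \<in> I" "j \<in> I" "S \<subseteq> U i \<inter> U j" for i j S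
    using cont[OF that(1,2)] that(3) by (rule continuous_map_from_subtopology_mono)
  show "\<rho> (gh i j x) \<otimes>\<^bsub>G\<^esub> \<rho> (gh j k x) = \<rho> (gh i k x)"
    if "i \<in> I" "j \<in> I" "k \<in> I" "x \<in> U i \<inter> U j \<inter> U k" for i j k x
    using transition_function_cocycle[OF lie_groups(2) triv[OF that(1)] tr[OF that(1,2)] tr[OF that(2,3)]
        tr[OF that(1,3)], of x] lift[of i j x] lift[of j k x] lift[of i k x] that by simp
qed

lemma dixmier_douady_cocycle_is_cocycle:
  assumes data: "dixmier_douady_data Gh G \<rho> Y M pr act I U \<Phi> g gh"
  shows "cech_cocycle (mtop M) U1 (mtop (mfd U1)) 2 I U (dixmier_douady_cocycle Gh \<iota> gh)"
  unfolding cech_cocycle_def cech_cochain_def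
proof (intro conjI ballI)
  note lifts = dixmier_douady_lifts[OF data]
  fix \<sigma> assume "\<sigma> \<in> simplices I 2"
  then obtain i j k where \<sigma>: "\<sigma> = [i, j, k]" "i \<in> I" "j \<in> I" "k \<in> I" by (auto simp: simplices_2)
  have s: "supp U \<sigma> = U i \<inter> U j \<inter> U k" by (auto simp: \<sigma>(1) supp_def)
  have "continuous_map (subtopology (mtop M) (supp U \<sigma>)) (top_of_set (sphere 0 1))
     (\<lambda>x. defect (gh i j x) (gh j k x) (gh i k x))"
    by (intro continuous_map_defect lifts(2)) (use \<sigma> s lifts(3) in auto)
  then show "continuous_map (subtopology (mtop M) (supp U \<sigma>)) (mtop (mfd U1)) (dixmier_douady_cocycle Gh \<iota> gh \<sigma>)"
    unfolding \<sigma>(1) dixmier_douady_cocycle_eq_defect[abs_def] by simp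
next
  note lifts = dixmier_douady_lifts[OF data]
  fix \<sigma> x assume "\<sigma> \<in> simplices I (Suc 2)" and x: "x \<in> supp U \<sigma>"
  then have "\<sigma> \<in> simplices I 3" by simp
  then obtain i j k l where \<sigma>: "\<sigma> = [i, j, k, l]" "i \<in> I" "j \<in> I" "k \<in> I" "l \<in> I"
    by (auto simp: simplices_3)
  have x': "x \<in> U i" "x \<in> U j" "x \<in> U k" "x \<in> U l" using x by (auto simp: \<sigma>(1) supp_def)
  have c: "gh u v x \<in> carrier Gh" if "u \<in> {i, j, k, l}" "v \<in> {i, j, k, l}" for u v
    using that x' \<sigma>(2-5) by (intro lifts(1)[THEN conjunct1]) auto
  have r: "\<rho> (gh u v x) \<otimes>\<^bsub>G\<^esub> \<rho> (gh v w x) = \<rho> (gh u w x)"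
    if "u \<in> {i, j, k, l}" "v \<in> {i, j, k, l}" "w \<in> {i, j, k, l}" for u v w
    using that x' \<sigma>(2-5) by (intro lifts(3)) auto
  have n: "norm (defect (gh u v x) (gh v w x) (gh u w x)) = 1"
    if "u \<in> {i, j, k, l}" "v \<in> {i, j, k, l}" "w \<in> {i, j, k, l}" for u v w
    using that by (intro norm_defect c r) auto
  show "cech_diff U1 (dixmier_douady_cocycle Gh \<iota> gh) \<sigma> x = \<one>\<^bsub>U1\<^esub>"
    unfolding \<sigma>(1)
    by (subst cech_diff_circle_tetrahedron)
      (simp_all add: dixmier_douady_cocycle_eq_defect n defect_cocycle c r)
qed

text \<open>The flat trivialization \<open>\<tau> x\<close> is related to \<open>\<Phi> (a x)\<close> by a continuous change of frame with a lift
  \<open>kh x\<close> on \<open>W x\<close>; the lift \<open>sh x y\<close> of the flat transition function \<open>\<gamma> x y\<close> is locally constant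
  whatever section \<open>sec\<close> of \<open>\<rho>\<close> is used. The defect of \<open>sh\<close> gives \<open>t\<close>, and \<open>e\<close> is the defect in the
  relation \<open>kh x \<otimes> gh (a x) (a y) = sh x y \<otimes> kh y\<close>.\<close>
lemma flat_cocycle_decomposition:
  assumes flat: "flat_bundle Y M G pr act"
    and data: "dixmier_douady_data Gh G \<rho> Y M pr act I U \<Phi> g gh"
    and index: "\<forall>x\<in>topspace (mtop M). a x \<in> I \<and> x \<in> U (a x)"
  obtains W t e where "pointed_cover (mtop M) W"
    "\<And>x. x \<in> topspace (mtop M) \<Longrightarrow> W x \<subseteq> U (a x)"
    "cech_cochain (mtop M) (discrete_topology UNIV) 2 (topspace (mtop M)) W t"
    "cech_cochain (mtop M) (top_of_set (sphere 0 1)) 1 (topspace (mtop M)) W e"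
    "\<forall>\<sigma>\<in>simplices (topspace (mtop M)) 3. \<forall>x\<in>supp W \<sigma>.
       cis (2 * pi * cech_diff real_group t \<sigma> x) = 1"
    "\<And>\<sigma> x. \<sigma> \<in> simplices (topspace (mtop M)) 2 \<Longrightarrow> x \<in> supp W \<sigma> \<Longrightarrow>
       dixmier_douady_cocycle Gh \<iota> gh (map a \<sigma>) x = cis (2 * pi * t \<sigma> x) * cech_diff U1 e \<sigma> x"
proof -
  let ?X = "topspace (mtop M)"
  note a = bspec[OF index]
  note lifts = dixmier_douady_lifts[OF data]
  have trivU: "local_trivialization Y M G pr act (U i) (\<Phi> i)" if "i \<in> I" for i
    using data that by (simp add: dixmier_douady_data_def)
  have trU: "transition_function G (U i) (\<Phi> i) (U j) (\<Phi> j) (g i j)" if "i \<in> I" "j \<in> I" for i j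
    using data that by (simp add: dixmier_douady_data_def)
  obtain \<T> where T: "\<Union> (fst ` \<T>) = ?X"
    "\<forall>(S, \<Psi>) \<in> \<T>. local_trivialization Y M G pr act S \<Psi>"
    "\<forall>(S, \<Psi>) \<in> \<T>. \<forall>(S', \<Psi>') \<in> \<T>. \<exists>\<gamma>. transition_function G S \<Psi> S' \<Psi>' \<gamma> \<and>
         continuous_map (subtopology (mtop M) (S \<inter> S')) (discrete_topology (carrier G)) \<gamma>"
    using flat unfolding flat_bundle_def by (elim exE conjE) (rule that)
  have "\<exists>\<tau> W kh. \<tau> \<in> \<T> \<and> openin (mtop M) W \<and> x \<in> W \<and> W \<subseteq> U (a x) \<inter> fst \<tau> \<and>
       continuous_map (subtopology (mtop M) W) (mtop (mfd Gh)) kh \<and>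
       transition_function G (fst \<tau>) (snd \<tau>) W (\<Phi> (a x)) (\<lambda>y. \<rho> (kh y))"
    if x: "x \<in> ?X" for x
  proof -
    have "x \<in> \<Union> (fst ` \<T>)" using T(1) x by simp
    then obtain q where q: "q \<in> \<T>" "x \<in> fst q" by blast
    obtain S \<Psi> where q_eq: "q = (S, \<Psi>)" by (cases q)
    have S: "(S, \<Psi>) \<in> \<T>" "x \<in> S" using q q_eq by simp_all
    have ax: "a x \<in> I" "x \<in> U (a x)" using a[OF x] by auto
    have triv: "local_trivialization Y M G pr act S \<Psi>" using T(2) S(1) by blast
    obtain k where k: "continuous_map (subtopology (mtop M) (S \<inter> U (a x))) (mtop (mfd G)) k"
      "transition_function G S \<Psi> (U (a x)) (\<Phi> (a x)) k"
      by (rule continuous_transition_function_exists[OF lie_groups(2) triv trivU[OF ax(1)]]) (rule that)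
    have xS: "x \<in> S \<inter> U (a x)" using S(2) ax(2) by (rule IntI)
    then have "k x \<in> carrier G" using k(2) by (simp add: transition_function_def)
    then obtain N s where N: "openin (mtop (mfd G)) N" "k x \<in> N"
      "continuous_map (subtopology (mtop (mfd G)) N) (mtop (mfd Gh)) s" "\<And>y. y \<in> N \<Longrightarrow> \<rho> (s y) = y"
      by (rule continuous_local_section) (rule that)
    have op: "openin (mtop M) (S \<inter> U (a x))"
      using triv trivU[OF ax(1)] by (simp add: local_trivialization_def openin_Int)
    (* On W the change of frame k takes its values in the domain N of the section s of \<rho>. *)
    define W where "W = {y \<in> topspace (subtopology (mtop M) (S \<inter> U (a x))). k y \<in> N}"
    have W: "openin (mtop M) W"
      using openin_continuous_map_preimage[OF k(1) N(1)] op unfolding W_def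
      by (simp only: openin_open_subtopology)
    have WS: "W \<subseteq> S \<inter> U (a x)" unfolding W_def by auto
    have "x \<in> W" using xS x N(2) by (simp add: W_def)
    have "continuous_map (subtopology (mtop M) W) (subtopology (mtop (mfd G)) N) k"
      using continuous_map_from_subtopology_mono[OF k(1) WS]
      by (auto simp: continuous_map_in_subtopology W_def)
    from continuous_map_compose[OF this N(3)]
    have "continuous_map (subtopology (mtop M) W) (mtop (mfd Gh)) (\<lambda>y. s (k y))" by (simp add: o_def)
    moreover have "transition_function G S \<Psi> W (\<Phi> (a x)) (\<lambda>y. \<rho> (s (k y)))"
      using k(2) N(4) WS by (auto simp: transition_function_def W_def)
    ultimately show ?thesis
      using S(1) W \<open>x \<in> W\<close> WS by (intro exI[of _ "(S, \<Psi>)"] exI[of _ W] exI[of _ "\<lambda>y. s (k y)"]) auto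
  qed
  then obtain \<tau> W kh where frame: "\<And>x. x \<in> ?X \<Longrightarrow> \<tau> x \<in> \<T> \<and> openin (mtop M) (W x) \<and> x \<in> W x \<and>
      W x \<subseteq> U (a x) \<inter> fst (\<tau> x) \<and> continuous_map (subtopology (mtop M) (W x)) (mtop (mfd Gh)) (kh x) \<and>
      transition_function G (fst (\<tau> x)) (snd (\<tau> x)) (W x) (\<Phi> (a x)) (\<lambda>y. \<rho> (kh x y))"
    by metis
  have "\<exists>\<gamma>. transition_function G (fst (\<tau> x)) (snd (\<tau> x)) (fst (\<tau> y)) (snd (\<tau> y)) \<gamma> \<and>
         continuous_map (subtopology (mtop M) (fst (\<tau> x) \<inter> fst (\<tau> y))) (discrete_topology (carrier G)) \<gamma>"
    if "x \<in> ?X" "y \<in> ?X" for x y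
    using T(3) frame[OF that(1)] frame[OF that(2)] by (auto simp: case_prod_beta)
  then obtain \<gamma> where
    \<gamma>: "\<And>x y. x \<in> ?X \<Longrightarrow> y \<in> ?X \<Longrightarrow>
        transition_function G (fst (\<tau> x)) (snd (\<tau> x)) (fst (\<tau> y)) (snd (\<tau> y)) (\<gamma> x y)"
    and \<gamma>_cont: "\<And>x y. x \<in> ?X \<Longrightarrow> y \<in> ?X \<Longrightarrow>
        continuous_map (subtopology (mtop M) (fst (\<tau> x) \<inter> fst (\<tau> y))) (discrete_topology (carrier G)) (\<gamma> x y)"
    by metis
  have triv\<tau>: "local_trivialization Y M G pr act (fst (\<tau> x)) (snd (\<tau> x))" if "x \<in> ?X" for x
    using T(2) frame[OF that] by (auto simp: case_prod_beta)
  define sec where "sec = inv_into (carrier Gh) \<rho>"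
  have onto: "\<rho> ` carrier Gh = carrier G" using extension by (simp add: central_extension_def)
  have sec: "sec y \<in> carrier Gh" "\<rho> (sec y) = y" if "y \<in> carrier G" for y
    using that unfolding sec_def onto[symmetric] by (rule inv_into_into, rule f_inv_into_f)
  define sh where "sh = (\<lambda>x y p. sec (\<gamma> x y p))"
  have sh: "sh x y p \<in> carrier Gh" "\<rho> (sh x y p) = \<gamma> x y p"
    if "x \<in> ?X" "y \<in> ?X" "p \<in> W x" "p \<in> W y" for x y p
  proof -
    have "\<gamma> x y p \<in> carrier G"
      using \<gamma>[OF that(1,2)] frame[OF that(1)] frame[OF that(2)] that unfolding transition_function_def by blast
    then show "sh x y p \<in> carrier Gh" "\<rho> (sh x y p) = \<gamma> x y p" unfolding sh_def by (rule sec)+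
  qed
  have Wtop: "W x \<subseteq> ?X" if "x \<in> ?X" for x using frame[OF that] openin_subset by blast
  have kh: "kh x p \<in> carrier Gh" if "x \<in> ?X" "p \<in> W x" for x p
    using frame[OF that(1)] Wtop[OF that(1)] that(2) Gh_top by (auto simp: continuous_map_def)
  have gh: "gh (a x) (a y) p \<in> carrier Gh" if "x \<in> ?X" "y \<in> ?X" "p \<in> W x" "p \<in> W y" for x y p
    using lifts(1)[of "a x" "a y" p] a frame that by blast
  have sh_cocycle: "\<rho> (sh x y p) \<otimes>\<^bsub>G\<^esub> \<rho> (sh y z p) = \<rho> (sh x z p)"
    if "x \<in> ?X" "y \<in> ?X" "z \<in> ?X" "p \<in> W x" "p \<in> W y" "p \<in> W z" for x y z p
  proof -
    have "\<gamma> x y p \<otimes>\<^bsub>G\<^esub> \<gamma> y z p = \<gamma> x z p"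
      by (rule transition_function_cocycle[OF lie_groups(2) triv\<tau> \<gamma> \<gamma> \<gamma>]) (use that frame in blast)+
    then show ?thesis using sh that by simp
  qed
  have gh_cocycle: "\<rho> (gh (a x) (a y) p) \<otimes>\<^bsub>G\<^esub> \<rho> (gh (a y) (a z) p) = \<rho> (gh (a x) (a z) p)"
    if "x \<in> ?X" "y \<in> ?X" "z \<in> ?X" "p \<in> W x" "p \<in> W y" "p \<in> W z" for x y z p
    by (rule lifts(3)) (use that a frame in blast)+
  (* Both sides take the flat trivialization at x to \<Phi> (a y). *)
  have kh_frame: "\<rho> (kh x p) \<otimes>\<^bsub>G\<^esub> \<rho> (gh (a x) (a y) p) = \<rho> (sh x y p) \<otimes>\<^bsub>G\<^esub> \<rho> (kh y p)"
    if "x \<in> ?X" "y \<in> ?X" "p \<in> W x" "p \<in> W y" for x y p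
  proof -
    have trg: "transition_function G (W x) (\<Phi> (a x)) (W y) (\<Phi> (a y)) (g (a x) (a y))"
      using trU[of "a x" "a y"] a frame that(1,2) unfolding transition_function_def by blast
    have trx: "transition_function G (fst (\<tau> x)) (snd (\<tau> x)) (W x) (\<Phi> (a x)) (\<lambda>y. \<rho> (kh x y))"
      and tr_y: "transition_function G (fst (\<tau> y)) (snd (\<tau> y)) (W y) (\<Phi> (a y)) (\<lambda>z. \<rho> (kh y z))"
      and p: "p \<in> fst (\<tau> x)" "p \<in> fst (\<tau> y)"
      using frame[OF that(1)] frame[OF that(2)] that(3,4) by auto
    have "\<rho> (kh x p) \<otimes>\<^bsub>G\<^esub> g (a x) (a y) p = \<gamma> x y p \<otimes>\<^bsub>G\<^esub> \<rho> (kh y p)"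
      using transition_function_compose[OF lie_groups(2) triv\<tau>[OF that(1)] trx trg \<gamma>[OF that(1,2)] tr_y
          p(1) that(3) p(2) that(4)] by simp
    moreover have "\<rho> (gh (a x) (a y) p) = g (a x) (a y) p"
      using lifts(1)[of "a x" "a y" p] a frame that by blast
    ultimately show ?thesis using sh(2)[OF that] by simp
  qed
  define D where "D = (\<lambda>x y z p. defect (sh x y p) (sh y z p) (sh x z p))"
  have D_norm: "norm (D x y z p) = 1"
    if "x \<in> ?X" "y \<in> ?X" "z \<in> ?X" "p \<in> W x" "p \<in> W y" "p \<in> W z" for x y z p
    unfolding D_def by (intro norm_defect sh sh_cocycle that)
  define t where "t = (\<lambda>\<sigma> p. Arg (D (\<sigma> ! 0) (\<sigma> ! 1) (\<sigma> ! 2) p) / (2 * pi))"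
  define E where "E = (\<lambda>x y p. defect (kh x p) (gh (a x) (a y) p) (sh x y p \<otimes>\<^bsub>Gh\<^esub> kh y p))"
  define e where "e = (\<lambda>\<sigma>. E (\<sigma> ! 0) (\<sigma> ! 1))"
  have e_list: "e [x, y] = E x y" for x y by (simp add: e_def)
  have E_rel: "\<rho> (kh x p) \<otimes>\<^bsub>G\<^esub> \<rho> (gh (a x) (a y) p) = \<rho> (sh x y p \<otimes>\<^bsub>Gh\<^esub> kh y p)"
    if "x \<in> ?X" "y \<in> ?X" "p \<in> W x" "p \<in> W y" for x y p
    using kh_frame[OF that] sh[OF that] kh that by simp
  have E_norm: "norm (E x y p) = 1"
    if "x \<in> ?X" "y \<in> ?X" "p \<in> W x" "p \<in> W y" for x y p
    unfolding E_def by (intro norm_defect E_rel kh gh sh Gh.m_closed that)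
  have t_cis: "cis (2 * pi * t [x, y, z] p) = D x y z p"
    if "x \<in> ?X" "y \<in> ?X" "z \<in> ?X" "p \<in> W x" "p \<in> W y" "p \<in> W z" for x y z p
  proof -
    have "D x y z p \<noteq> 0" using D_norm[OF that] by auto
    then have "cis (Arg (D x y z p)) = D x y z p"
      using D_norm[OF that] by (simp add: cis_Arg sgn_div_norm)
    then show ?thesis by (simp add: t_def numeral_2_eq_2)
  qed
  show ?thesis
  proof (rule that[of W t e])
    show "pointed_cover (mtop M) W" using frame by (simp add: pointed_cover_def)
    show "W x \<subseteq> U (a x)" if "x \<in> ?X" for x using frame[OF that] by blast
    show "cech_cochain (mtop M) (discrete_topology UNIV) 2 ?X W t"
      unfolding cech_cochain_def
    proof
      fix \<sigma> assume "\<sigma> \<in> simplices ?X 2"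
      then obtain x y z where \<sigma>: "\<sigma> = [x, y, z]" "x \<in> ?X" "y \<in> ?X" "z \<in> ?X"
        by (auto simp: simplices_2)
      let ?S = "subtopology (mtop M) (supp W \<sigma>)"
      have *: "continuous_map ?S (discrete_topology (carrier G)) (\<gamma> u v)"
        if "u \<in> {x, y, z}" "v \<in> {x, y, z}" for u v
      proof (rule continuous_map_from_subtopology_mono[OF \<gamma>_cont])
        show "u \<in> ?X" "v \<in> ?X" using that \<sigma> by auto
        then show "supp W \<sigma> \<subseteq> fst (\<tau> u) \<inter> fst (\<tau> v)"
          using that frame[of u] frame[of v] by (auto simp: supp_def \<sigma>(1))
      qed
      have "continuous_map ?S (discrete_topology UNIV) (\<lambda>p. (\<gamma> x y p, \<gamma> y z p))"
        by (rule continuous_map_discrete_combine[OF *[of x y] *[of y z], where F = Pair]) auto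
      then have "continuous_map ?S (discrete_topology UNIV)
          (\<lambda>p. (\<lambda>uv w. Arg (defect (sec (fst uv)) (sec (snd uv)) (sec w)) / (2 * pi)) (\<gamma> x y p, \<gamma> y z p) (\<gamma> x z p))"
        by (rule continuous_map_discrete_combine[OF _ *[of x z]]) auto
      then show "continuous_map ?S (discrete_topology UNIV) (t \<sigma>)"
        by (simp add: t_def D_def sh_def \<sigma>(1) numeral_2_eq_2)
    qed
    show "cech_cochain (mtop M) (top_of_set (sphere 0 1)) 1 ?X W e"
      unfolding cech_cochain_def
    proof
      fix \<sigma> assume "\<sigma> \<in> simplices ?X 1"
      then obtain x y where \<sigma>: "\<sigma> = [x, y]" "x \<in> ?X" "y \<in> ?X" by (auto simp: simplices_1)
      let ?S = "subtopology (mtop M) (supp W \<sigma>)"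
      have s: "supp W \<sigma> = W x \<inter> W y" by (auto simp: \<sigma>(1) supp_def)
      have k: "continuous_map ?S (mtop (mfd Gh)) (kh u)" if "u \<in> {x, y}" for u
      proof (rule continuous_map_from_subtopology_mono)
        show "continuous_map (subtopology (mtop M) (W u)) (mtop (mfd Gh)) (kh u)"
          using frame[of u] that \<sigma> by auto
      qed (use that s in auto)
      have "continuous_map ?S (discrete_topology (carrier G)) (\<gamma> x y)"
        by (rule continuous_map_from_subtopology_mono[OF \<gamma>_cont[OF \<sigma>(2,3)]])
          (use s frame[OF \<sigma>(2)] frame[OF \<sigma>(3)] in blast)
      then have shc: "continuous_map ?S (mtop (mfd Gh)) (sh x y)"
        unfolding sh_def by (rule continuous_map_from_discrete) (use sec Gh_top in auto)
      have ghc: "continuous_map ?S (mtop (mfd Gh)) (gh (a x) (a y))"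
        by (rule lifts(2)) (use a s frame \<sigma> in blast)+
      show "continuous_map ?S (top_of_set (sphere 0 1)) (e \<sigma>)"
        unfolding \<sigma>(1) e_list unfolding \<sigma>(1)[symmetric] E_def
      proof (rule continuous_map_defect)
        show "continuous_map ?S (mtop (mfd Gh)) (kh x)" "continuous_map ?S (mtop (mfd Gh)) (gh (a x) (a y))"
          using k ghc by auto
        show "continuous_map ?S (mtop (mfd Gh)) (\<lambda>p. sh x y p \<otimes>\<^bsub>Gh\<^esub> kh y p)"
          by (intro lie_group_topology(3)[OF lie_groups(1)] shc k) auto
        show "\<rho> (kh x p) \<otimes>\<^bsub>G\<^esub> \<rho> (gh (a x) (a y) p) = \<rho> (sh x y p \<otimes>\<^bsub>Gh\<^esub> kh y p)"
          if "p \<in> topspace ?S" for p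
          using that s by (intro E_rel \<sigma>) auto
      qed
    qed
    show "\<forall>\<sigma>\<in>simplices ?X 3. \<forall>p\<in>supp W \<sigma>. cis (2 * pi * cech_diff real_group t \<sigma> p) = 1"
    proof (intro ballI)
      fix \<sigma> p assume that: "\<sigma> \<in> simplices ?X 3" "p \<in> supp W \<sigma>"
      obtain x y z w where \<sigma>: "\<sigma> = [x, y, z, w]" "x \<in> ?X" "y \<in> ?X" "z \<in> ?X" "w \<in> ?X"
        using \<open>\<sigma> \<in> simplices ?X 3\<close> by (auto simp: simplices_3)
      have p: "p \<in> W x" "p \<in> W y" "p \<in> W z" "p \<in> W w" using that(2) by (auto simp: \<sigma>(1) supp_def)
      have "cis (2 * pi * cech_diff real_group t \<sigma> p) =
         D y z w p * inverse (D x z w p) * D x y w p * inverse (D x y z p)"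
        unfolding cech_diff_circle_cis[symmetric] \<sigma>(1)
        using \<sigma>(2-5) p by (subst cech_diff_circle_tetrahedron) (simp_all add: t_cis D_norm)
      also have "\<dots> = 1" unfolding D_def by (intro defect_cocycle sh sh_cocycle \<sigma> p)
      finally show "cis (2 * pi * cech_diff real_group t \<sigma> p) = 1" .
    qed
    show "dixmier_douady_cocycle Gh \<iota> gh (map a \<sigma>) p = cis (2 * pi * t \<sigma> p) * cech_diff U1 e \<sigma> p"
      if "\<sigma> \<in> simplices ?X 2" "p \<in> supp W \<sigma>" for \<sigma> p
    proof -
      obtain x y z where \<sigma>: "\<sigma> = [x, y, z]" "x \<in> ?X" "y \<in> ?X" "z \<in> ?X"
        using \<open>\<sigma> \<in> simplices ?X 2\<close> by (auto simp: simplices_2)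
      have p: "p \<in> W x" "p \<in> W y" "p \<in> W z" using that(2) by (auto simp: \<sigma>(1) supp_def)
      have "cech_diff U1 e \<sigma> p = E y z p * inverse (E x z p) * E x y p"
        unfolding \<sigma>(1) using \<sigma>(2-4) p by (subst cech_diff_circle_triangle) (simp_all add: e_list E_norm)
      moreover have "dixmier_douady_cocycle Gh \<iota> gh (map a \<sigma>) p =
          D x y z p * (E y z p * inverse (E x z p) * E x y p)"
        unfolding \<sigma>(1) list.map dixmier_douady_cocycle_eq_defect D_def E_def
        by (intro defect_change_of_frame gh sh kh gh_cocycle sh_cocycle kh_frame \<sigma> p)
      ultimately show ?thesis using t_cis[OF \<sigma>(2-4) p] \<sigma>(1) by simp
    qed
  qed
qed

end

section \<open>Vanishing of the real Dixmier--Douady class\<close>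

lemma norm_eq_1_imp_nonzero: "norm z = 1 \<Longrightarrow> z \<noteq> (0::'a::real_normed_vector)"
  by auto

theorem corollary3p1:
  fixes G :: "('g, 'f::locally_convex_space) lie_group"
    and Gh :: "('h, 'a::locally_convex_space) lie_group"
    and \<iota> :: "complex \<Rightarrow> 'h" and \<rho> :: "'h \<Rightarrow> 'g"
    and M :: "('m, 'e::real_normed_vector) manifold"
    and Y :: "('p, 'q::locally_convex_space) manifold"
    and pr :: "'p \<Rightarrow> 'm" and act :: "'p \<Rightarrow> 'g \<Rightarrow> 'p"
    and I :: "'i set" and U :: "'i \<Rightarrow> 'm set" and \<Phi> :: "'i \<Rightarrow> 'm \<times> 'g \<Rightarrow> 'p"
    and g :: "'i \<Rightarrow> 'i \<Rightarrow> 'm \<Rightarrow> 'g" and gh :: "'i \<Rightarrow> 'i \<Rightarrow> 'm \<Rightarrow> 'h"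
  assumes "is_lie_group G"
    and "finite_dimensional TYPE('f) \<or> admits_smooth_partitions_of_unity (mfd G)"
    and "central_extension Gh G \<iota> \<rho>"
    and "is_finite_dim_manifold M"
    and "principal_bundle Y M G pr act"
    and "flat_bundle Y M G pr act"
    and "dixmier_douady_data Gh G \<rho> Y M pr act I U \<Phi> g gh"
  shows "int_to_real_H3 (mtop M) (dixmier_douady_class Gh \<iota> (mtop M) I U gh) =
         H3_real_zero (mtop M)"
proof -
  interpret circle_extension Gh G \<iota> \<rho> by unfold_locales (fact assms(3))
  note flat = assms(6) and data = assms(7)
  let ?X = "mtop M" and ?c = "dixmier_douady_cocycle Gh \<iota> gh"
  let ?I = "topspace ?X" and ?T = "mtop (mfd U1)"
  let ?K = "cech_class ?X U1 ?T 2 I U ?c" and ?zero = "(\<lambda>_. ?I, \<lambda>_ _. 0 :: real)"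
  have reg: "regular_space ?X" by (rule finite_dim_manifold_regular[OF assms(4)])
  have lind: "Lindelof_space ?X"
    using assms(4) by (simp add: is_finite_dim_manifold_def second_countable_imp_Lindelof_space)
  have cover: "\<Union> (U ` I) = ?I" and opn: "\<And>i. i \<in> I \<Longrightarrow> openin ?X (U i)"
    using data by (simp_all add: dixmier_douady_data_def leray_cover_def)
  obtain a where a: "\<forall>x\<in>?I. a x \<in> I \<and> x \<in> U (a x)"
    using cover by (metis UN_E)

  (* An integral representative: on W the cocycle is cohomologous to cis (2 pi t), and the locally
     constant t is in particular a continuous real cochain, so its coboundary represents the class. *)
  have nonempty: "\<exists>V n. (V, n) \<in> dixmier_douady_class Gh \<iota> ?X I U gh"
  proof -
    obtain W t e where W: "pointed_cover ?X W" "\<And>x. x \<in> ?I \<Longrightarrow> W x \<subseteq> U (a x)"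
      and t: "cech_cochain ?X (discrete_topology UNIV) 2 ?I W t"
      and e: "cech_cochain ?X (top_of_set (sphere 0 1)) 1 ?I W e"
      and int: "\<forall>\<sigma>\<in>simplices ?I 3. \<forall>x\<in>supp W \<sigma>. cis (2 * pi * cech_diff real_group t \<sigma> x) = 1"
      and dec: "\<And>\<sigma> x. \<sigma> \<in> simplices ?I 2 \<Longrightarrow> x \<in> supp W \<sigma> \<Longrightarrow>
         ?c (map a \<sigma>) x = cis (2 * pi * t \<sigma> x) * cech_diff U1 e \<sigma> x"
      by (rule flat_cocycle_decomposition[OF flat data a]) (rule that)
    define n where "n = (\<lambda>\<sigma> x. \<lfloor>cech_diff real_group t \<sigma> x\<rfloor>)"
    have n: "real_of_int (n \<sigma> x) = cech_diff real_group t \<sigma> x"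
      if "\<sigma> \<in> simplices ?I 3" "x \<in> supp W \<sigma>" for \<sigma> x
      unfolding n_def by (rule integral_coboundary_of_locally_constant(1)[OF t int that])
    have n_rep: "(W, n) \<in> cech_reps ?X integer_group (discrete_topology UNIV) 3"
      using integral_coboundary_of_locally_constant(2)[OF t int] W(1) by (simp add: cech_reps_def n_def)
    have c_rep: "(U \<circ> a, \<lambda>\<sigma>. ?c (map a \<sigma>)) \<in> cech_reps ?X U1 ?T 2"
      using cech_cocycle_reindex[OF dixmier_douady_cocycle_is_cocycle[OF data], of ?I a "U \<circ> a"] a opn
      by (simp add: cech_reps_def pointed_cover_def)
    have "((U \<circ> a, \<lambda>\<sigma>. ?c (map a \<sigma>)), (W, \<lambda>\<sigma> x. cis (2 * pi * t \<sigma> x))) \<in> cech_rel ?X U1 ?T (Suc 1)"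
      unfolding cech_rel_Suc_iff
      using c_rep exp_locally_constant_in_circle_reps[OF W(1) t int] W e dec
      by (intro conjI exI[of _ W] exI[of _ e]) (simp_all add: numeral_2_eq_2)
    then have "(W, \<lambda>\<sigma> x. cis (2 * pi * t \<sigma> x)) \<in> ?K"
      using a unfolding cech_class_def numeral_2_eq_2 One_nat_def by blast
    moreover have "cech_cochain ?X euclideanreal 2 ?I W t"
      using t unfolding cech_cochain_def
      by (auto intro: continuous_map_from_discrete[where A = UNIV and h = "\<lambda>x. x"])
    moreover have "((W, n), (W, n)) \<in> cech_rel ?X integer_group (discrete_topology UNIV) (Suc 2)"
      unfolding cech_rel_Suc_iff
      using n_rep W(1) by (intro conjI exI[of _ W] exI[of _ "\<lambda>_ _. 0"])
        (auto simp: numeral_3_eq_3 numeral_2_eq_2 cech_cochain_def cech_diff_int Let_def cong: if_cong)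
    ultimately have "(W, n) \<in> exp_connecting ?X ?K"
      unfolding exp_connecting_def using n by (intro ImageI[of "(W, n)"]) (auto simp: numeral_3_eq_3)
    then show ?thesis unfolding dixmier_douady_class_def by blast
  qed

  (* A representative (V, n) is cohomologous to some n1 = coboundary of b on V1, and cis (2 pi b) to
     the Dixmier--Douady cocycle with respect to some choice a' of indices. *)
  have trivial: "((V, \<lambda>\<sigma> x. real_of_int (n \<sigma> x)), ?zero) \<in> real_rel ?X 3"
    if rep: "(V, n) \<in> dixmier_douady_class Gh \<iota> ?X I U gh" for V n
  proof -
    obtain V1 n1 b where rel: "((V1, n1), (V, n)) \<in> cech_rel ?X integer_group (discrete_topology UNIV) 3"
      and b: "cech_cochain ?X euclideanreal 2 ?I V1 b"
      and bK: "(V1, \<lambda>\<sigma> x. cis (2 * pi * b \<sigma> x)) \<in> ?K"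
      and n1: "\<forall>\<sigma>\<in>simplices ?I 3. \<forall>x\<in>supp V1 \<sigma>. real_of_int (n1 \<sigma> x) = cech_diff real_group b \<sigma> x"
      using rep unfolding dixmier_douady_class_def exp_connecting_def by auto
    obtain a' where a': "\<forall>x\<in>?I. a' x \<in> I \<and> x \<in> U (a' x)"
      and relK: "((U \<circ> a', \<lambda>\<sigma>. ?c (map a' \<sigma>)), (V1, \<lambda>\<sigma> x. cis (2 * pi * b \<sigma> x))) \<in> cech_rel ?X U1 ?T 2"
      using bK unfolding cech_class_def by auto
    obtain W1 e1 where W1: "pointed_cover ?X W1" "\<forall>x\<in>?I. W1 x \<subseteq> (U \<circ> a') x \<inter> V1 x"
      and e1: "cech_cochain ?X (top_of_set (sphere 0 1)) 1 ?I W1 e1"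
      and eq1: "\<forall>\<sigma>\<in>simplices ?I 2. \<forall>x\<in>supp W1 \<sigma>.
         ?c (map a' \<sigma>) x = cis (2 * pi * b \<sigma> x) * cech_diff U1 e1 \<sigma> x"
      using relK unfolding numeral_2_eq_2 cech_rel_Suc_iff by auto
    obtain W t e where W: "pointed_cover ?X W" "\<And>x. x \<in> ?I \<Longrightarrow> W x \<subseteq> U (a' x)"
      and t: "cech_cochain ?X (discrete_topology UNIV) 2 ?I W t"
      and e: "cech_cochain ?X (top_of_set (sphere 0 1)) 1 ?I W e"
      and int: "\<forall>\<sigma>\<in>simplices ?I 3. \<forall>x\<in>supp W \<sigma>. cis (2 * pi * cech_diff real_group t \<sigma> x) = 1"
      and dec: "\<And>\<sigma> x. \<sigma> \<in> simplices ?I 2 \<Longrightarrow> x \<in> supp W \<sigma> \<Longrightarrow>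
         ?c (map a' \<sigma>) x = cis (2 * pi * t \<sigma> x) * cech_diff U1 e \<sigma> x"
      by (rule flat_cocycle_decomposition[OF flat data a']) (rule that)
    let ?W = "\<lambda>x. W x \<inter> W1 x"
    let ?e = "\<lambda>\<sigma> x. e \<sigma> x * inverse (e1 \<sigma> x)"
    have "cech_cochain ?X (top_of_set (sphere 0 1)) 1 ?I ?W e"
      "cech_cochain ?X (top_of_set (sphere 0 1)) 1 ?I ?W e1"
      using cech_cochain_mono[OF e, of ?W] cech_cochain_mono[OF e1, of ?W] by auto
    then have ee: "continuous_map (subtopology ?X (supp ?W \<sigma>)) (top_of_set (sphere 0 1)) (e \<sigma>)"
      "continuous_map (subtopology ?X (supp ?W \<sigma>)) (top_of_set (sphere 0 1)) (e1 \<sigma>)"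
      if "\<sigma> \<in> simplices ?I 1" for \<sigma>
      using that by (auto simp: cech_cochain_def)
    have norms: "norm (e \<sigma> x) = 1" "norm (e1 \<sigma> x) = 1"
      if "\<sigma> \<in> simplices ?I 1" "x \<in> supp ?W \<sigma>" "x \<in> ?I" for \<sigma> x
      using ee[OF that(1)] that(2,3) by (auto simp: continuous_map_in_subtopology)
    have "((V1, \<lambda>\<sigma> x. real_of_int (n1 \<sigma> x)), ?zero) \<in> real_rel ?X 3"
    proof (rule coboundary_of_exp_flat_cochain_is_trivial[OF reg lind])
      show "(V1, \<lambda>\<sigma> x. real_of_int (n1 \<sigma> x)) \<in> cech_reps ?X real_group (discrete_topology UNIV) 3"
        using rel by (intro integral_reps_imp_real_reps) (auto simp: cech_rel_def)
      show "cech_cochain ?X euclideanreal 2 ?I V1 b" by (fact b)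
      show "real_of_int (n1 \<sigma> x) = cech_diff real_group b \<sigma> x"
        if "\<sigma> \<in> simplices ?I 3" "x \<in> supp V1 \<sigma>" for \<sigma> x using n1 that by blast
      show "pointed_cover ?X ?W" by (rule pointed_cover_Int[OF W(1) W1(1)])
      show "?W x \<subseteq> V1 x" if "x \<in> ?I" for x using W1(2) that by blast
      show "cech_cochain ?X (discrete_topology UNIV) 2 ?I ?W (\<lambda>\<sigma> x. cis (2 * pi * t \<sigma> x))"
        using cech_cochain_mono[OF t, of ?W] unfolding cech_cochain_def
        by (auto intro!: continuous_map_from_discrete[where A = UNIV and h = "\<lambda>y. cis (2 * pi * y)"])
      show "cech_cochain ?X (top_of_set (sphere 0 1)) 1 ?I ?W ?e"
        unfolding cech_cochain_def
      proof
        fix \<sigma> assume \<sigma>: "\<sigma> \<in> simplices ?I 1"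
        have "continuous_map (prod_topology (top_of_set (sphere 0 1)) (top_of_set (sphere 0 1)))
            (top_of_set (sphere 0 (1::real))) (\<lambda>(u, v). u * inverse v :: complex)"
          by (auto simp: case_prod_beta norm_mult norm_inverse continuous_map_in_subtopology
              simp flip: subtopology_Times intro!: continuous_intros)
        from continuous_map_compose[OF continuous_map_pairedI[OF ee[OF \<sigma>]] this]
        show "continuous_map (subtopology ?X (supp ?W \<sigma>)) (top_of_set (sphere 0 1)) (?e \<sigma>)"
          by (simp add: o_def)
      qed
      fix \<sigma> p assume \<sigma>: "\<sigma> \<in> simplices ?I 2" and p: "p \<in> supp ?W \<sigma>"
      obtain x y z where xyz: "\<sigma> = [x, y, z]" "x \<in> ?I" "y \<in> ?I" "z \<in> ?I"
        using \<sigma> by (auto simp: simplices_2)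
      have p': "p \<in> supp W \<sigma>" "p \<in> supp W1 \<sigma>" using p by (auto simp: supp_def)
      have "p \<in> ?I" using p pointed_cover_subset[OF W(1) xyz(2)] by (auto simp: xyz(1) supp_def)
      then have nrm: "norm (e [u, v] p) = 1" "norm (e1 [u, v] p) = 1"
        if "u \<in> {x, y, z}" "v \<in> {x, y, z}" for u v
        using that xyz p by (intro norms; auto simp: simplices_1 supp_def)+
      have nz: "e [u, v] p \<noteq> 0" "e1 [u, v] p \<noteq> 0" if "u \<in> {x, y, z}" "v \<in> {x, y, z}" for u v
        using norm_eq_1_imp_nonzero[OF nrm(1)[OF that]] norm_eq_1_imp_nonzero[OF nrm(2)[OF that]]
        by simp_all
      have nz_diff: "cech_diff U1 e1 \<sigma> p \<noteq> 0"
        unfolding xyz(1) by (simp add: cech_diff_circle_triangle nrm nz)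
      have "cech_diff U1 ?e \<sigma> p * cech_diff U1 e1 \<sigma> p = cech_diff U1 e \<sigma> p"
        unfolding xyz(1) by (simp add: cech_diff_circle_triangle nrm norm_mult norm_inverse)
          (simp add: nz divide_simps)
      moreover have "cis (2 * pi * b \<sigma> p) * cech_diff U1 e1 \<sigma> p = cis (2 * pi * t \<sigma> p) * cech_diff U1 e \<sigma> p"
        using bspec[OF bspec[OF eq1 \<sigma>] p'(2)] dec[OF \<sigma> p'(1)] by simp
      ultimately have "cis (2 * pi * b \<sigma> p) * cech_diff U1 e1 \<sigma> p =
          (cis (2 * pi * t \<sigma> p) * cech_diff U1 ?e \<sigma> p) * cech_diff U1 e1 \<sigma> p"
        by simp
      then show "cis (2 * pi * b \<sigma> p) = cis (2 * pi * t \<sigma> p) * cech_diff U1 ?e \<sigma> p"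
        using nz_diff by simp
    qed
    moreover have "((V1, \<lambda>\<sigma> x. real_of_int (n1 \<sigma> x)), (V, \<lambda>\<sigma> x. real_of_int (n \<sigma> x))) \<in> real_rel ?X 3"
      using integral_rel_imp_real_rel[of V1 n1 V n ?X 2] rel by (simp add: numeral_3_eq_3 numeral_2_eq_2)
    ultimately show ?thesis
      unfolding numeral_3_eq_3 by (meson real_rel_sym real_rel_trans)
  qed

  (* Both sides are equivalence classes of the same relation, so one common element suffices. *)
  have sym: "(q, p) \<in> real_rel ?X 3" if "(p, q) \<in> real_rel ?X 3" for p q
    using real_rel_sym that unfolding numeral_3_eq_3 .
  have trans: "(p, r) \<in> real_rel ?X 3" if "(p, q) \<in> real_rel ?X 3" "(q, r) \<in> real_rel ?X 3" for p q r
    using real_rel_trans that unfolding numeral_3_eq_3 .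
  obtain V0 n0 where VN: "(V0, n0) \<in> dixmier_douady_class Gh \<iota> ?X I U gh" using nonempty by blast
  show ?thesis
    unfolding int_to_real_H3_def cech_zero_def real_group_one
  proof (intro equalityI subsetI)
    fix p assume "p \<in> real_rel ?X 3 ``
      {(V, \<lambda>\<sigma> x. real_of_int (n \<sigma> x)) |V n. (V, n) \<in> dixmier_douady_class Gh \<iota> ?X I U gh}"
    then obtain V n where "(V, n) \<in> dixmier_douady_class Gh \<iota> ?X I U gh"
      "((V, \<lambda>\<sigma> x. real_of_int (n \<sigma> x)), p) \<in> real_rel ?X 3" by auto
    then show "p \<in> real_rel ?X 3 `` {?zero}" using trans[OF sym[OF trivial]] by blast
  next
    fix p assume "p \<in> real_rel ?X 3 `` {?zero}"
    then have "(?zero, p) \<in> real_rel ?X 3" by blast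
    from trans[OF trivial[OF VN] this]
    show "p \<in> real_rel ?X 3 ``
      {(V, \<lambda>\<sigma> x. real_of_int (n \<sigma> x)) |V n. (V, n) \<in> dixmier_douady_class Gh \<iota> ?X I U gh}"
      using VN by blast
  qed
qed

end
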